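(* Let $\mu$ be the adjoint (biregular) representation of the Hopf algebra $H_1^i$ on itself, $\mu(a)x=\sum a_{(1)}\,x\,S(a_{(2)})$, and let $\mathrm{Tr}_\mu(a)=\mathrm{Tr}(\mu(a))$, $a\in H_1^i$. 1) On the basis $e_0,e_1,E_0,E_1,F_0,F_1,C_0,C_1$ the representation $\mu$ takes the following values (all values on basis elements not listed are $0$): - $\mu(e_0)$ fixes $e_0,e_1,C_0,C_1$ and annihilates $E_0,E_1,F_0,F_1$; - $\mu(e_1)$ fixes $E_0,E_1,F_0,F_1$ and annihilates $e_0,e_1,C_0,C_1$; - $\mu(E_0)F_0=\mu(E_0)F_1=C_0+C_1$; - $\mu(E_1)e_0=-E_0+E_1$, $\mu(E_1)e_1=E_0-E_1$; - $\mu(F_0)E_0=-C_0-C_1$, $\mu(F_0)E_1=C_0+C_1$; - $\mu(F_1)e_0=F_0+F_1$, $\mu(F_1)e_1=-F_0-F_1$; - $\mu(C_0)e_0=2(C_0+C_1)$, $\mu(C_0)e_1=-2(C_0+C_1)$; - $\mu(C_1)=0$. 2) $\mathrm{Tr}_\mu(e_0)=\mathrm{Tr}_\mu(e_1)=4$ and $\mathrm{Tr}_\mu$ vanishes on $E_0,E_1,F_0,F_1,C_0,C_1$. Thus $\mathrm{Tr}_\mu$ has the nilradical $N_1^i$ in its kernel and passes to the semi-simple quotient $H_1^i/N_1^i\cong\mathbb{C}\oplus\mathbb{C}$ as ($4$ times) its usual trace $(\alpha,\beta)\mapsto\alpha+\beta$. 3) The scalar product $\langle a,b\rangle=\frac14\mathrm{Tr}_\mu(a^*b)$,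 $a,b\in H_1^i$, has as its only non-vanishing values on pairs of basis elements $\langle e_0,e_0\rangle=1$ and $\langle e_1,e_1\rangle=1$. In other terms $\langle\cdot,\cdot\rangle$ is positive semi-definite with null-space the nilradical $N_1^i$.
   Context: $H_1^i$ is the unital associative $\mathbb{C}$-algebra generated by $K,E,F$ with relations $KE=-EK$, $KF=-FK$, $EF=FE$, $E^2=F^2=0$, $K^2=\mathbf 1$. It is a Hopf algebra with $\Delta(K)=K\otimes K$, $\Delta(E)=E\otimes\mathbf 1+K\otimes E$, $\Delta(F)=F\otimes K^{-1}+\mathbf 1\otimes F$, $\varepsilon(K)=1$, $\varepsilon(E)=\varepsilon(F)=0$, $S(K)=K^{-1}$, $S(E)=-K^{-1}E$, $S(F)=-FK$ (here $K^{-1}=K$). Put $e_0=\frac{\mathbf 1+K}{2}$, $e_1=\frac{\mathbf 1-K}{2}$, and for $j=0,1$: $E_j=e_jE$, $F_j=e_jF$, $C_j=e_jEF$; these eight elements form a basis of $H_1^i$. The $*$-operation is the antilinear, antimultiplicative involution with $E^*=F$, $F^*=E$, $K^*=K$. $N_1^i$ denotes the span of $E_0,E_1,F_0,F_1,C_0,C_1$, which is the nilradical of $H_1^i$. Sweedler notation $\Delta(a)=\sum a_{(1)}\otimes a_{(2)}$ is used. *)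

theory Defs
  imports Complex_Main "HOL-Library.Poly_Mapping" "HOL-Library.Product_Plus"
begin

section \<open>Complex algebras\<close>

text \<open>Unital associative algebras over the complex numbers (the zero algebra is allowed, hence
  \<^class>\<open>ring\<close> and \<^class>\<open>monoid_mult\<close> rather than \<^class>\<open>ring_1\<close>).\<close>

class complex_algebra = ring + monoid_mult +
  fixes cscale :: "complex \<Rightarrow> 'a \<Rightarrow> 'a"  (infixr \<open>*\<^sub>C\<close> 75)
  assumes cscale_add_right: "c *\<^sub>C (x + y) = c *\<^sub>C x + c *\<^sub>C y"
    and cscale_add_left: "(c + d) *\<^sub>C x = c *\<^sub>C x + d *\<^sub>C x"
    and cscale_cscale: "c *\<^sub>C (d *\<^sub>C x) = (c * d) *\<^sub>C x"
    and cscale_one: "1 *\<^sub>C x = x"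
    and cscale_mult_left: "(c *\<^sub>C x) * y = c *\<^sub>C (x * y)"
    and cscale_mult_right: "x * (c *\<^sub>C y) = c *\<^sub>C (x * y)"

global_interpretation cvec: vector_space "cscale :: complex \<Rightarrow> 'a \<Rightarrow> 'a::complex_algebra"
  by standard (simp_all add: cscale_add_right cscale_add_left cscale_cscale cscale_one)

instantiation complex :: complex_algebra
begin
definition cscale_complex :: "complex \<Rightarrow> complex \<Rightarrow> complex" where "cscale_complex = (*)"
instance by standard (simp_all add: cscale_complex_def algebra_simps)
end

instantiation prod :: (complex_algebra, complex_algebra) complex_algebra
begin
definition one_prod :: "'a \<times> 'b" where "one_prod = (1, 1)"
definition times_prod :: "'a \<times> 'b \<Rightarrow> 'a \<times> 'b \<Rightarrow> 'a \<times> 'b"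
  where "times_prod x y = (fst x * fst y, snd x * snd y)"
definition cscale_prod :: "complex \<Rightarrow> 'a \<times> 'b \<Rightarrow> 'a \<times> 'b"
  where "cscale_prod c x = (c *\<^sub>C fst x, c *\<^sub>C snd x)"
instance
  by standard (simp_all add: one_prod_def times_prod_def cscale_prod_def prod_eq_iff algebra_simps
      cscale_add_right cscale_add_left cscale_cscale cscale_one cscale_mult_left cscale_mult_right)
end

definition algebra_hom :: "('a::complex_algebra \<Rightarrow> 'b::complex_algebra) \<Rightarrow> bool"
  where "algebra_hom \<phi> \<longleftrightarrow> \<phi> 1 = 1 \<and> (\<forall>x y. \<phi> (x + y) = \<phi> x + \<phi> y)
    \<and> (\<forall>x y. \<phi> (x * y) = \<phi> x * \<phi> y) \<and> (\<forall>c x. \<phi> (c *\<^sub>C x) = c *\<^sub>C \<phi> x)"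

definition algebra_iso :: "('a::complex_algebra \<Rightarrow> 'b::complex_algebra) \<Rightarrow> bool"
  where "algebra_iso \<phi> \<longleftrightarrow> algebra_hom \<phi> \<and> bij \<phi>"

definition two_sided_ideal :: "'a::complex_algebra set \<Rightarrow> bool"
  where "two_sided_ideal I \<longleftrightarrow> cvec.subspace I \<and> (\<forall>a. \<forall>x\<in>I. a * x \<in> I \<and> x * a \<in> I)"

text \<open>The nilradical: the largest two-sided ideal consisting of nilpotent elements.\<close>

definition nilradical :: "'a::complex_algebra set"
  where "nilradical = \<Union>{I. two_sided_ideal I \<and> (\<forall>x\<in>I. \<exists>n. x ^ n = 0)}"

text \<open>The trace of an endomorphism of a finite-dimensional space, computed in an arbitrarily chosen
  basis; \<open>ltrace_eq\<close> below shows independence of the choice.\<close>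

definition (in vector_space) ltrace :: "('b \<Rightarrow> 'b) \<Rightarrow> 'a"
  where "ltrace f = (\<Sum>b\<in>extend_basis {}. representation (extend_basis {}) (f b) b)"

lemma (in vector_space) ltrace_eq:
  assumes lin: "Vector_Spaces.linear scale scale f"
    and fin: "finite B" and ind: "independent B" and sp: "span B = UNIV"
  shows "ltrace f = (\<Sum>b\<in>B. representation B (f b) b)"
proof -
  interpret f: Vector_Spaces.linear scale scale f by fact
  define X where "X = extend_basis {}"
  have Xi: "independent X" and Xs: "span X = UNIV"
    unfolding X_def using independent_extend_basis span_extend_basis independent_empty by blast+
  have Xf: "finite X"
    using independent_span_bound[OF fin Xi] sp by simp
  have exp1: "f b = (\<Sum>c\<in>C. scale (representation C (f b) c) c)"
    if "independent C" "span C = UNIV" "finite C" for b C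
    using sum_representation_eq[of C "f b" C] that by simp
  have exp: "v = (\<Sum>c\<in>C. scale (representation C v c) c)"
    if "independent C" "span C = UNIV" "finite C" for v C
    using sum_representation_eq[of C v C] that by simp
  have rlin: "representation C (\<Sum>c\<in>D. scale (g c) (h c)) b
      = (\<Sum>c\<in>D. g c * representation C (h c) b)"
    if "independent C" "span C = UNIV" for C D g h b
    using that by (simp add: representation_sum representation_scale)
  have "(\<Sum>b\<in>X. representation X (f b) b)
      = (\<Sum>b\<in>X. representation X (f (\<Sum>c\<in>B. scale (representation B b c) c)) b)"
    using exp[OF ind sp fin] by simp
  also have "\<dots> = (\<Sum>b\<in>X. \<Sum>c\<in>B. representation B b c * representation X (f c) b)"
    by (simp add: f.sum f.scale rlin[OF Xi Xs])
  also have "\<dots> = (\<Sum>c\<in>B. \<Sum>b\<in>X. representation X (f c) b * representation B b c)"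
    by (subst sum.swap) (simp add: mult.commute)
  also have "\<dots> = (\<Sum>c\<in>B. representation B (\<Sum>b\<in>X. scale (representation X (f c) b) b) c)"
    by (simp add: rlin[OF ind sp])
  also have "\<dots> = (\<Sum>c\<in>B. representation B (f c) c)"
    using exp[OF Xi Xs Xf] by simp
  finally show ?thesis by (simp add: ltrace_def X_def)
qed

section \<open>Monoid algebras and their quotients\<close>

text \<open>\<open>'m \<Rightarrow>\<^sub>0 complex\<close> is the monoid algebra of the (additively written) monoid \<open>'m\<close>.
  For \<open>\<sigma>\<close> the identity (or complex conjugation), \<open>semilin \<sigma> f\<close> is the linear (antilinear) extension
  of a map \<open>f\<close> defined on the monoid.\<close>

definition semilin :: "(complex \<Rightarrow> complex) \<Rightarrow> ('m \<Rightarrow> 'a) \<Rightarrow> ('m \<Rightarrow>\<^sub>0 complex) \<Rightarrow> 'a::complex_algebra"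
  where "semilin \<sigma> f p = (\<Sum>m\<in>Poly_Mapping.keys p. \<sigma> (Poly_Mapping.lookup p m) *\<^sub>C f m)"

definition scalar_hom :: "(complex \<Rightarrow> complex) \<Rightarrow> bool"
  where "scalar_hom \<sigma> \<longleftrightarrow> \<sigma> 0 = 0 \<and> \<sigma> 1 = 1 \<and> (\<forall>x y. \<sigma> (x + y) = \<sigma> x + \<sigma> y) \<and> (\<forall>x y. \<sigma> (x * y) = \<sigma> x * \<sigma> y)"

lemma scalar_hom_id [simp]: "scalar_hom id" and scalar_hom_cnj [simp]: "scalar_hom cnj"
  by (simp_all add: scalar_hom_def)

lemma semilin_superset:
  assumes "scalar_hom \<sigma>" "finite A" "Poly_Mapping.keys p \<subseteq> A"
  shows "semilin \<sigma> f p = (\<Sum>m\<in>A. \<sigma> (Poly_Mapping.lookup p m) *\<^sub>C f m)"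
  unfolding semilin_def using assms
  by (intro sum.mono_neutral_left) (auto simp: in_keys_iff scalar_hom_def)

lemma semilin_zero [simp]: "semilin \<sigma> f 0 = 0"
  by (simp add: semilin_def)

lemma semilin_add:
  assumes "scalar_hom \<sigma>"
  shows "semilin \<sigma> f (p + q) = semilin \<sigma> f p + semilin \<sigma> f q"
proof -
  let ?A = "Poly_Mapping.keys p \<union> Poly_Mapping.keys q"
  have "semilin \<sigma> f x = (\<Sum>m\<in>?A. \<sigma> (Poly_Mapping.lookup x m) *\<^sub>C f m)" if "x \<in> {p, q, p + q}" for x
    using that by (intro semilin_superset assms) (auto dest: subsetD[OF Poly_Mapping.keys_add])
  then show ?thesis
    using assms by (simp add: lookup_add scalar_hom_def cscale_add_left sum.distrib)
qed

lemma semilin_uminus: "scalar_hom \<sigma> \<Longrightarrow> semilin \<sigma> f (- p) = - semilin \<sigma> f p"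
  using semilin_add[of \<sigma> f p "- p"] by (simp add: eq_neg_iff_add_eq_0 add.commute)

lemma semilin_diff: "scalar_hom \<sigma> \<Longrightarrow> semilin \<sigma> f (p - q) = semilin \<sigma> f p - semilin \<sigma> f q"
  using semilin_add[of \<sigma> f p "- q"] by (simp add: semilin_uminus)

lemma semilin_sum:
  "scalar_hom \<sigma> \<Longrightarrow> semilin \<sigma> f (sum g A) = (\<Sum>i\<in>A. semilin \<sigma> f (g i))"
  by (induction A rule: infinite_finite_induct) (simp_all add: semilin_add)

lemma semilin_single [simp]:
  assumes "scalar_hom \<sigma>"
  shows "semilin \<sigma> f (Poly_Mapping.single m c) = \<sigma> c *\<^sub>C f m"
  using assms by (subst semilin_superset[where A = "{m}"]) (auto simp: scalar_hom_def)

lemma semilin_one: "scalar_hom \<sigma> \<Longrightarrow> semilin \<sigma> f 1 = f 0"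
  unfolding single_one[symmetric] by (subst semilin_single) (simp_all add: scalar_hom_def)

lemma poly_mapping_induct [case_names single add]:
  assumes "\<And>m c. P (Poly_Mapping.single m c)" and "\<And>p q. P p \<Longrightarrow> P q \<Longrightarrow> P (p + q)"
  shows "P (p :: 'm \<Rightarrow>\<^sub>0 complex)"
proof (induction p rule: update_induct)
  case const
  then show ?case using assms(1)[of undefined 0] by simp
next
  case (update p a b)
  have "Poly_Mapping.update a b p = p + Poly_Mapping.single a b"
    using update by (intro poly_mapping_eqI) (auto simp: lookup_update lookup_add lookup_single in_keys_iff)
  then show ?case using assms(1) assms(2) update.IH by metis
qed

lemma semilin_scale:
  assumes "scalar_hom \<sigma>"
  shows "semilin \<sigma> f (Poly_Mapping.single 0 c * p) = \<sigma> c *\<^sub>C semilin \<sigma> f (p :: 'm::monoid_add \<Rightarrow>\<^sub>0 complex)"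
proof (induction p rule: poly_mapping_induct)
  case (single m d)
  then show ?case using assms by (simp add: mult_single cscale_cscale scalar_hom_def)
qed (simp add: assms distrib_left semilin_add cscale_add_right)

lemma semilin_mult:
  assumes \<sigma>: "scalar_hom \<sigma>" and f: "\<And>m n. f (m + n) = f m * f n"
  shows "semilin \<sigma> f (p * q) = semilin \<sigma> f p * semilin \<sigma> f (q :: 'm::monoid_add \<Rightarrow>\<^sub>0 complex)"
proof (induction p rule: poly_mapping_induct)
  case (single m c)
  show ?case
  proof (induction q rule: poly_mapping_induct)
    case (single n d)
    show ?case using \<sigma>
      by (simp add: mult_single f cscale_mult_left cscale_mult_right cscale_cscale scalar_hom_def)
  qed (simp add: \<sigma> distrib_left semilin_add)
qed (simp add: \<sigma> distrib_right semilin_add)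

lemma semilin_mult_anti:
  assumes \<sigma>: "scalar_hom \<sigma>" and f: "\<And>m n. f (m + n) = f n * f m"
  shows "semilin \<sigma> f (p * q) = semilin \<sigma> f q * semilin \<sigma> f (p :: 'm::monoid_add \<Rightarrow>\<^sub>0 complex)"
proof (induction p rule: poly_mapping_induct)
  case (single m c)
  show ?case
  proof (induction q rule: poly_mapping_induct)
    case (single n d)
    show ?case using \<sigma>
      by (simp add: mult_single f cscale_mult_left cscale_mult_right cscale_cscale scalar_hom_def mult.commute)
  qed (simp add: \<sigma> distrib_left distrib_right semilin_add)
qed (simp add: \<sigma> distrib_left distrib_right semilin_add)

text \<open>The two-sided ideal of a ring generated by a set. In a monoid algebra it is closed under
  scalars, these being the elements \<open>single 0 c\<close>.\<close>

inductive_set ideal_gen :: "'a::ring_1 set \<Rightarrow> 'a set" for R where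
  ideal_zero: "0 \<in> ideal_gen R"
| ideal_base: "r \<in> R \<Longrightarrow> a * r * b \<in> ideal_gen R"
| ideal_add: "x \<in> ideal_gen R \<Longrightarrow> y \<in> ideal_gen R \<Longrightarrow> x + y \<in> ideal_gen R"

lemma ideal_gen_mult_left: "x \<in> ideal_gen R \<Longrightarrow> c * x \<in> ideal_gen R"
  by (induction rule: ideal_gen.induct)
    (auto simp: distrib_left mult.assoc[symmetric] intro: ideal_gen.intros)

lemma ideal_gen_mult_right: "x \<in> ideal_gen R \<Longrightarrow> x * c \<in> ideal_gen R"
proof (induction rule: ideal_gen.induct)
  case (ideal_base r a b)
  then show ?case using ideal_gen.ideal_base[of r R a "b * c"] by (simp add: mult.assoc)
qed (auto simp: distrib_right intro: ideal_gen.intros)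

lemma ideal_gen_uminus: "x \<in> ideal_gen R \<Longrightarrow> - x \<in> ideal_gen R"
  using ideal_gen_mult_left[of x R "- 1"] by simp

lemma ideal_gen_diff: "x \<in> ideal_gen R \<Longrightarrow> y \<in> ideal_gen R \<Longrightarrow> x - y \<in> ideal_gen R"
  using ideal_add[of x R "- y"] ideal_gen_uminus[of y R] by simp

lemma ideal_gen_superset: "r \<in> R \<Longrightarrow> r \<in> ideal_gen R"
  using ideal_base[of r R 1 1] by simp

lemma ideal_gen_diff_mult:
  assumes "x - x' \<in> ideal_gen R" "y - y' \<in> ideal_gen R"
  shows "x * y - x' * y' \<in> ideal_gen R"
proof -
  have "x * y - x' * y' = (x - x') * y + x' * (y - y')" by (simp add: algebra_simps)
  then show ?thesis using assms by (simp add: ideal_add ideal_gen_mult_left ideal_gen_mult_right)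
qed

lemma ideal_gen_diff_add:
  assumes "x - x' \<in> ideal_gen R" "y - y' \<in> ideal_gen R"
  shows "x + y - (x' + y') \<in> ideal_gen R"
  using ideal_add[OF assms] by (simp add: algebra_simps)

lemma ideal_gen_diff_diff:
  assumes "x - x' \<in> ideal_gen R" "y - y' \<in> ideal_gen R"
  shows "x - y - (x' - y') \<in> ideal_gen R"
  using ideal_gen_diff[OF assms] by (simp add: algebra_simps)

lemma ideal_gen_diff_uminus:
  assumes "x - x' \<in> ideal_gen R"
  shows "- x - - x' \<in> ideal_gen R"
  using ideal_gen_uminus[OF assms] by (simp add: algebra_simps)

lemma ideal_gen_diff_mult_left:
  assumes "x - x' \<in> ideal_gen R"
  shows "c * x - c * x' \<in> ideal_gen R"
  using ideal_gen_mult_left[OF assms, of c] by (simp add: algebra_simps)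

lemma ideal_gen_eq: "x = y \<Longrightarrow> x - y \<in> ideal_gen R"
  by (simp add: ideal_zero)

lemma ideal_gen_equivp: "equivp (\<lambda>x y. x - y \<in> ideal_gen R)"
proof (rule equivpI)
  show "reflp (\<lambda>x y. x - y \<in> ideal_gen R)" by (simp add: reflp_def ideal_zero)
  show "symp (\<lambda>x y. x - y \<in> ideal_gen R)"
    unfolding symp_def using ideal_gen_uminus by (metis minus_diff_eq)
  show "transp (\<lambda>x y. x - y \<in> ideal_gen R)"
    unfolding transp_def using ideal_add by (metis diff_add_cancel add_diff_eq)
qed

lemma semilin_ideal_gen:
  assumes \<sigma>: "scalar_hom \<sigma>" and f: "\<And>m n. f (m + n) = f m * f n"
    and R: "\<And>r. r \<in> R \<Longrightarrow> semilin \<sigma> f r = 0" and x: "x \<in> ideal_gen R"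
  shows "semilin \<sigma> f x = 0"
  using x by induction (simp_all add: semilin_add semilin_mult \<sigma> f R)

lemma semilin_ideal_gen_anti:
  assumes \<sigma>: "scalar_hom \<sigma>" and f: "\<And>m n. f (m + n) = f n * f m"
    and R: "\<And>r. r \<in> R \<Longrightarrow> semilin \<sigma> f r = 0" and x: "x \<in> ideal_gen R"
  shows "semilin \<sigma> f x = 0"
  using x by induction (simp_all add: semilin_add semilin_mult_anti \<sigma> f R)

lemma single_0_commute:
  "p * (Poly_Mapping.single 0 c * q) = Poly_Mapping.single 0 c * (p * q)"
  for p q :: "'m::monoid_add \<Rightarrow>\<^sub>0 complex"
proof -
  have "p * Poly_Mapping.single 0 c = Poly_Mapping.single 0 c * p"
    by (induction p rule: poly_mapping_induct) (simp_all add: mult_single mult.commute algebra_simps)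
  then show ?thesis by (metis mult.assoc)
qed

section \<open>The algebra\<close>

datatype gen = GK | GE | GF

text \<open>The free monoid on the three generators, written additively; \<open>gen_word \<Rightarrow>\<^sub>0 complex\<close> is thus the
  free complex algebra on them.\<close>

datatype gen_word = Word (letters: "gen list")

instantiation gen_word :: monoid_add
begin
definition zero_gen_word :: gen_word where "0 = Word []"
definition plus_gen_word :: "gen_word \<Rightarrow> gen_word \<Rightarrow> gen_word" where "u + v = Word (letters u @ letters v)"
instance by standard (simp_all add: zero_gen_word_def plus_gen_word_def)
end

definition free_gen :: "gen \<Rightarrow> (gen_word \<Rightarrow>\<^sub>0 complex)"
  where "free_gen g = Poly_Mapping.single (Word [g]) 1"

definition H1i_relators :: "(gen_word \<Rightarrow>\<^sub>0 complex) set"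
  where "H1i_relators = (let k = free_gen GK; e = free_gen GE; f = free_gen GF in
    {k * e + e * k, k * f + f * k, e * f - f * e, e * e, f * f, k * k - 1})"

quotient_type H1i = "gen_word \<Rightarrow>\<^sub>0 complex" / "\<lambda>x y. x - y \<in> ideal_gen H1i_relators"
  by (rule ideal_gen_equivp)

instantiation H1i :: complex_algebra
begin
lift_definition zero_H1i :: H1i is 0 .
lift_definition one_H1i :: H1i is 1 .
lift_definition plus_H1i :: "H1i \<Rightarrow> H1i \<Rightarrow> H1i" is "(+)"
  by (rule ideal_gen_diff_add)
lift_definition minus_H1i :: "H1i \<Rightarrow> H1i \<Rightarrow> H1i" is "(-)"
  by (rule ideal_gen_diff_diff)
lift_definition uminus_H1i :: "H1i \<Rightarrow> H1i" is uminus
  by (rule ideal_gen_diff_uminus)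
lift_definition times_H1i :: "H1i \<Rightarrow> H1i \<Rightarrow> H1i" is "(*)"
  by (rule ideal_gen_diff_mult)
lift_definition cscale_H1i :: "complex \<Rightarrow> H1i \<Rightarrow> H1i" is "\<lambda>c p. Poly_Mapping.single 0 c * p"
  by (rule ideal_gen_diff_mult_left)
instance
  by standard
    (transfer, rule ideal_gen_eq,
      (simp add: algebra_simps; fail | simp add: single_add distrib_right; fail
        | simp add: mult.assoc[symmetric] mult_single; fail | rule single_0_commute))+
end

definition word_hom :: "(gen \<Rightarrow> 'a::monoid_mult) \<Rightarrow> gen_word \<Rightarrow> 'a"
  where "word_hom \<phi> w = prod_list (map \<phi> (letters w))"

definition word_antihom :: "(gen \<Rightarrow> 'a::monoid_mult) \<Rightarrow> gen_word \<Rightarrow> 'a"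
  where "word_antihom \<phi> w = prod_list (rev (map \<phi> (letters w)))"

lemma word_hom_plus: "word_hom \<phi> (u + v) = word_hom \<phi> u * word_hom \<phi> v"
  and word_antihom_plus: "word_antihom \<phi> (u + v) = word_antihom \<phi> v * word_antihom \<phi> u"
  by (simp_all add: word_hom_def word_antihom_def plus_gen_word_def)

lemma word_hom_relators:
  assumes \<sigma>: "scalar_hom \<sigma>" and "\<phi> GK * \<phi> GE = - (\<phi> GE * \<phi> GK)" "\<phi> GK * \<phi> GF = - (\<phi> GF * \<phi> GK)"
    "\<phi> GE * \<phi> GF = \<phi> GF * \<phi> GE" "\<phi> GE * \<phi> GE = 0" "\<phi> GF * \<phi> GF = 0" "\<phi> GK * \<phi> GK = 1"
    and "x - y \<in> ideal_gen H1i_relators"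
  shows "semilin \<sigma> (word_hom \<phi>) x = semilin \<sigma> (word_hom \<phi>) y"
proof -
  have "\<sigma> 1 = 1" using \<sigma> by (simp add: scalar_hom_def)
  then have "semilin \<sigma> (word_hom \<phi>) r = 0" if "r \<in> H1i_relators" for r
    using that assms unfolding H1i_relators_def Let_def free_gen_def
    by (auto simp: mult_single semilin_add semilin_diff semilin_one word_hom_def plus_gen_word_def
        zero_gen_word_def cscale_one)
  then have "semilin \<sigma> (word_hom \<phi>) (x - y) = 0"
    by (rule semilin_ideal_gen[where f = "word_hom \<phi>", OF \<sigma> word_hom_plus _ assms(8)])
  then show ?thesis by (simp add: semilin_diff \<sigma>)
qed

lemma word_antihom_relators:
  assumes \<sigma>: "scalar_hom \<sigma>" and "\<phi> GK * \<phi> GE = - (\<phi> GE * \<phi> GK)" "\<phi> GK * \<phi> GF = - (\<phi> GF * \<phi> GK)"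
    "\<phi> GE * \<phi> GF = \<phi> GF * \<phi> GE" "\<phi> GE * \<phi> GE = 0" "\<phi> GF * \<phi> GF = 0" "\<phi> GK * \<phi> GK = 1"
    and "x - y \<in> ideal_gen H1i_relators"
  shows "semilin \<sigma> (word_antihom \<phi>) x = semilin \<sigma> (word_antihom \<phi>) y"
proof -
  have "\<sigma> 1 = 1" using \<sigma> by (simp add: scalar_hom_def)
  then have "semilin \<sigma> (word_antihom \<phi>) r = 0" if "r \<in> H1i_relators" for r
    using that assms unfolding H1i_relators_def Let_def free_gen_def
    by (auto simp: mult_single semilin_add semilin_diff semilin_one word_antihom_def plus_gen_word_def
        zero_gen_word_def cscale_one)
  then have "semilin \<sigma> (word_antihom \<phi>) (x - y) = 0"
    by (rule semilin_ideal_gen_anti[where f = "word_antihom \<phi>", OF \<sigma> word_antihom_plus _ assms(8)])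
  then show ?thesis by (simp add: semilin_diff \<sigma>)
qed

lift_definition HK :: H1i is "free_gen GK" .
lift_definition HE :: H1i is "free_gen GE" .
lift_definition HF :: H1i is "free_gen GF" .

lemma H1i_relations:
  shows "HK * HE = - (HE * HK)" "HK * HF = - (HF * HK)" "HE * HF = HF * HE"
    "HE * HE = 0" "HF * HF = 0" "HK * HK = 1"
  by (transfer, rule ideal_gen_superset, simp add: H1i_relators_def Let_def)+

lemma cscale_minus_simps:
  "(- c) *\<^sub>C x = - (c *\<^sub>C x)" "c *\<^sub>C (- x) = - (c *\<^sub>C x)" "c *\<^sub>C (x - y) = c *\<^sub>C x - c *\<^sub>C y" "c *\<^sub>C 0 = 0" "0 *\<^sub>C x = 0"
  for x :: "'a::complex_algebra"
  by (simp_all only: cvec.scale_minus_left cvec.scale_minus_right cvec.scale_right_diff_distrib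
      cvec.scale_zero_left cvec.scale_zero_right)

section \<open>The Hopf algebra structure\<close>

text \<open>The tensor square: the monoid algebra of the multiplicative monoid of pairs (with
  \<open>(a, b) (c, d) = (a c, b d)\<close>), that is, the free vector space on pairs with the product of
  pure tensors, modulo bilinearity.\<close>

datatype tpair = TPair (tleft: H1i) (tright: H1i)

instantiation tpair :: monoid_add
begin
definition zero_tpair :: tpair where "0 = TPair 1 1"
definition plus_tpair :: "tpair \<Rightarrow> tpair \<Rightarrow> tpair"
  where "s + t = TPair (tleft s * tleft t) (tright s * tright t)"
instance by standard (simp_all add: zero_tpair_def plus_tpair_def mult.assoc)
end

abbreviation (input) pure :: "H1i \<Rightarrow> H1i \<Rightarrow> tpair \<Rightarrow>\<^sub>0 complex"
  where "pure x y \<equiv> Poly_Mapping.single (TPair x y) 1"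

inductive_set tensor_relators :: "(tpair \<Rightarrow>\<^sub>0 complex) set" where
  "pure (x + y) z - (pure x z + pure y z) \<in> tensor_relators"
| "pure x (y + z) - (pure x y + pure x z) \<in> tensor_relators"
| "pure (c *\<^sub>C x) y - Poly_Mapping.single 0 c * pure x y \<in> tensor_relators"
| "pure x (c *\<^sub>C y) - Poly_Mapping.single 0 c * pure x y \<in> tensor_relators"

quotient_type H1i_tensor = "tpair \<Rightarrow>\<^sub>0 complex" / "\<lambda>x y. x - y \<in> ideal_gen tensor_relators"
  by (rule ideal_gen_equivp)

instantiation H1i_tensor :: complex_algebra
begin
lift_definition zero_H1i_tensor :: H1i_tensor is 0 .
lift_definition one_H1i_tensor :: H1i_tensor is 1 .
lift_definition plus_H1i_tensor :: "H1i_tensor \<Rightarrow> H1i_tensor \<Rightarrow> H1i_tensor" is "(+)"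
  by (rule ideal_gen_diff_add)
lift_definition minus_H1i_tensor :: "H1i_tensor \<Rightarrow> H1i_tensor \<Rightarrow> H1i_tensor" is "(-)"
  by (rule ideal_gen_diff_diff)
lift_definition uminus_H1i_tensor :: "H1i_tensor \<Rightarrow> H1i_tensor" is uminus
  by (rule ideal_gen_diff_uminus)
lift_definition times_H1i_tensor :: "H1i_tensor \<Rightarrow> H1i_tensor \<Rightarrow> H1i_tensor" is "(*)"
  by (rule ideal_gen_diff_mult)
lift_definition cscale_H1i_tensor :: "complex \<Rightarrow> H1i_tensor \<Rightarrow> H1i_tensor" is "\<lambda>c p. Poly_Mapping.single 0 c * p"
  by (rule ideal_gen_diff_mult_left)
instance
  by standard
    (transfer, rule ideal_gen_eq,
      (simp add: algebra_simps; fail | simp add: single_add distrib_right; fail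
        | simp add: mult.assoc[symmetric] mult_single; fail | rule single_0_commute))+
end

lift_definition tensor :: "H1i \<Rightarrow> H1i \<Rightarrow> H1i_tensor"  (infixl \<open>\<otimes>\<close> 76)
  is "\<lambda>x y. Poly_Mapping.single (TPair x y) 1" .

lemma tensor_bilinear:
  shows tensor_add_left: "(x + y) \<otimes> z = x \<otimes> z + y \<otimes> z"
    and tensor_add_right: "x \<otimes> (y + z) = x \<otimes> y + x \<otimes> z"
    and tensor_cscale_left: "(c *\<^sub>C x) \<otimes> y = c *\<^sub>C (x \<otimes> y)"
    and tensor_cscale_right: "x \<otimes> (c *\<^sub>C y) = c *\<^sub>C (x \<otimes> y)"
  by (transfer, rule ideal_gen_superset, rule tensor_relators.intros)+

lemma tensor_mult: "(x \<otimes> y) * (z \<otimes> w) = (x * z) \<otimes> (y * w)"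
  by (transfer, rule ideal_gen_eq) (simp add: mult_single plus_tpair_def)

lemma tensor_one: "1 \<otimes> 1 = 1"
  by (transfer, rule ideal_gen_eq) (simp add: zero_tpair_def[symmetric])

lemma tensor_zero: "0 \<otimes> x = 0" "x \<otimes> 0 = 0"
  using tensor_cscale_left[of 0 0 x] tensor_cscale_right[of x 0 0] by (simp_all only: cscale_minus_simps)

lemma tensor_uminus: "(- x) \<otimes> y = - (x \<otimes> y)" "x \<otimes> (- y) = - (x \<otimes> y)"
proof -
  have "(- 1) *\<^sub>C z = - z" for z :: H1i by (simp only: cscale_minus_simps cscale_one)
  moreover have "(- 1) *\<^sub>C z = - z" for z :: H1i_tensor by (simp only: cscale_minus_simps cscale_one)
  ultimately show "(- x) \<otimes> y = - (x \<otimes> y)" "x \<otimes> (- y) = - (x \<otimes> y)"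
    using tensor_cscale_left[of "- 1" x y] tensor_cscale_right[of x "- 1" y] by metis+
qed

text \<open>In the following definitions \<open>HK\<close> also stands for its own inverse.\<close>

definition Delta_gen :: "gen \<Rightarrow> H1i_tensor"
  where "Delta_gen g = (case g of GK \<Rightarrow> HK \<otimes> HK
    | GE \<Rightarrow> HE \<otimes> 1 + HK \<otimes> HE
    | GF \<Rightarrow> HF \<otimes> HK + 1 \<otimes> HF)"

definition antipode_gen :: "gen \<Rightarrow> H1i"
  where "antipode_gen g = (case g of GK \<Rightarrow> HK | GE \<Rightarrow> - (HK * HE) | GF \<Rightarrow> - (HF * HK))"

definition star_gen :: "gen \<Rightarrow> H1i"
  where "star_gen g = (case g of GK \<Rightarrow> HK | GE \<Rightarrow> HF | GF \<Rightarrow> HE)"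

text \<open>The values on generators are extended as algebra homomorphisms (\<open>Delta\<close>, \<open>counit\<close>), as a linear
  antihomomorphism (\<open>antipode\<close>) and as an antilinear antihomomorphism (\<open>star\<close>).\<close>

lemma Delta_gen_relations:
  shows "Delta_gen GK * Delta_gen GE = - (Delta_gen GE * Delta_gen GK)"
    "Delta_gen GK * Delta_gen GF = - (Delta_gen GF * Delta_gen GK)"
    "Delta_gen GE * Delta_gen GF = Delta_gen GF * Delta_gen GE"
    "Delta_gen GE * Delta_gen GE = 0" "Delta_gen GF * Delta_gen GF = 0"
    "Delta_gen GK * Delta_gen GK = 1"
  by (simp_all add: Delta_gen_def distrib_left distrib_right tensor_mult tensor_uminus tensor_one
      tensor_zero H1i_relations)

lift_definition Delta :: "H1i \<Rightarrow> H1i_tensor" is "semilin id (word_hom Delta_gen)"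
  by (rule word_hom_relators[OF scalar_hom_id Delta_gen_relations])

lift_definition counit :: "H1i \<Rightarrow> complex"
  is "semilin id (word_hom (\<lambda>g. case g of GK \<Rightarrow> 1 | GE \<Rightarrow> 0 | GF \<Rightarrow> 0))"
  by (rule word_hom_relators[OF scalar_hom_id]) simp_all

lemma H1i_relations_assoc:
  shows "HK * (HE * x) = - (HE * (HK * x))" "HK * (HF * x) = - (HF * (HK * x))" "HE * (HF * x) = HF * (HE * x)"
    "HE * (HE * x) = 0" "HF * (HF * x) = 0" "HK * (HK * x) = x"
  using H1i_relations by (metis mult.assoc mult_minus_left mult_zero_left mult_1_left)+

lemma antipode_gen_relations:
  shows "antipode_gen GK * antipode_gen GE = - (antipode_gen GE * antipode_gen GK)" 
    "antipode_gen GK * antipode_gen GF = - (antipode_gen GF * antipode_gen GK)"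
    "antipode_gen GE * antipode_gen GF = antipode_gen GF * antipode_gen GE"
    "antipode_gen GE * antipode_gen GE = 0" "antipode_gen GF * antipode_gen GF = 0"
    "antipode_gen GK * antipode_gen GK = 1"
  by (simp_all add: antipode_gen_def mult.assoc H1i_relations H1i_relations_assoc)

lift_definition antipode :: "H1i \<Rightarrow> H1i" is "semilin id (word_antihom antipode_gen)"
  by (rule word_antihom_relators[OF scalar_hom_id antipode_gen_relations])

lift_definition star :: "H1i \<Rightarrow> H1i" is "semilin cnj (word_antihom star_gen)"
  by (rule word_antihom_relators[OF scalar_hom_cnj])
    (simp_all add: star_gen_def H1i_relations)

lemma semilin_id_hom:
  "semilin id f (p + q) = semilin id f p + semilin id f q"
  "semilin id f (Poly_Mapping.single 0 c * r) = c *\<^sub>C semilin id f r"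
  by (simp_all add: semilin_add semilin_scale)

lemma scalar_hom_id' [simp]: "scalar_hom (\<lambda>a. a)"
  by (simp add: scalar_hom_def)

lemma semilin_free_gen:
  assumes "scalar_hom \<sigma>"
  shows "semilin \<sigma> (word_hom \<phi>) (free_gen g) = \<phi> g" "semilin \<sigma> (word_antihom \<phi>) (free_gen g) = \<phi> g"
  using assms by (simp_all add: free_gen_def word_hom_def word_antihom_def)
    (simp_all add: scalar_hom_def cscale_one)

lemma H1i_gens: "abs_H1i (free_gen GK) = HK" "abs_H1i (free_gen GE) = HE" "abs_H1i (free_gen GF) = HF"
  by (simp_all add: HK_def HE_def HF_def)

lemma Delta_hom: "algebra_hom Delta"
  unfolding algebra_hom_def
proof (intro conjI allI)
  show "Delta 1 = 1" by transfer (simp add: semilin_one word_hom_def zero_gen_word_def)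
  show "Delta (x + y) = Delta x + Delta y" for x y by transfer (rule semilin_id_hom)
  show "Delta (x * y) = Delta x * Delta y" for x y
    by transfer (rule semilin_mult[OF scalar_hom_id word_hom_plus])
  show "Delta (c *\<^sub>C x) = c *\<^sub>C Delta x" for c x by transfer (rule semilin_id_hom)
qed

lemma Delta_values: "Delta HK = HK \<otimes> HK" "Delta HE = HE \<otimes> 1 + HK \<otimes> HE" "Delta HF = HF \<otimes> HK + 1 \<otimes> HF"
  using Delta.abs_eq[of "free_gen GK"] Delta.abs_eq[of "free_gen GE"] Delta.abs_eq[of "free_gen GF"]
  by (simp_all add: H1i_gens semilin_free_gen Delta_gen_def)

lemma counit_hom: "algebra_hom counit"
  unfolding algebra_hom_def
proof (intro conjI allI)
  show "counit 1 = 1" by transfer (simp add: semilin_one word_hom_def zero_gen_word_def)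
  show "counit (x + y) = counit x + counit y" for x y by transfer (rule semilin_id_hom)
  show "counit (x * y) = counit x * counit y" for x y
    by transfer (rule semilin_mult[OF scalar_hom_id word_hom_plus])
  show "counit (c *\<^sub>C x) = c *\<^sub>C counit x" for c x by transfer (rule semilin_id_hom)
qed

lemma counit_values: "counit HK = 1" "counit HE = 0" "counit HF = 0"
  using counit.abs_eq[of "free_gen GK"] counit.abs_eq[of "free_gen GE"] counit.abs_eq[of "free_gen GF"]
  by (simp_all add: H1i_gens semilin_free_gen)

lemma antipode_antihom:
  shows antipode_one: "antipode 1 = 1"
    and antipode_add: "antipode (x + y) = antipode x + antipode y"
    and antipode_mult: "antipode (x * y) = antipode y * antipode x"
    and antipode_cscale: "antipode (c *\<^sub>C x) = c *\<^sub>C antipode x"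
proof -
  show "antipode 1 = 1" by transfer (simp add: semilin_one word_antihom_def zero_gen_word_def)
  show "antipode (x + y) = antipode x + antipode y" by transfer (rule semilin_id_hom)
  show "antipode (x * y) = antipode y * antipode x"
    by transfer (rule semilin_mult_anti[OF scalar_hom_id word_antihom_plus])
  show "antipode (c *\<^sub>C x) = c *\<^sub>C antipode x" by transfer (rule semilin_id_hom)
qed

lemma antipode_values: "antipode HK = HK" "antipode HE = - (HK * HE)" "antipode HF = - (HF * HK)"
  using antipode.abs_eq[of "free_gen GK"] antipode.abs_eq[of "free_gen GE"] antipode.abs_eq[of "free_gen GF"]
  by (simp_all add: H1i_gens semilin_free_gen antipode_gen_def)

lemma star_antihom:
  shows star_one: "star 1 = 1"
    and star_add: "star (x + y) = star x + star y"
    and star_mult: "star (x * y) = star y * star x"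
    and star_cscale: "star (c *\<^sub>C x) = cnj c *\<^sub>C star x"
proof -
  show "star 1 = 1" by transfer (simp add: semilin_one word_antihom_def zero_gen_word_def)
  show "star (x + y) = star x + star y" by transfer (simp add: semilin_add)
  show "star (x * y) = star y * star x"
    by transfer (rule semilin_mult_anti[OF scalar_hom_cnj word_antihom_plus])
  show "star (c *\<^sub>C x) = cnj c *\<^sub>C star x" by transfer (simp add: semilin_scale)
qed

lemma star_values: "star HK = HK" "star HE = HF" "star HF = HE"
  using star.abs_eq[of "free_gen GK"] star.abs_eq[of "free_gen GE"] star.abs_eq[of "free_gen GF"]
  by (simp_all add: H1i_gens semilin_free_gen star_gen_def)

section \<open>The adjoint representation and its trace\<close>

lemma sandwich_relators:
  fixes x :: H1i and p q :: "tpair \<Rightarrow>\<^sub>0 complex"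
  defines "f \<equiv> \<lambda>m. tleft m * x * antipode (tright m)"
  assumes "p - q \<in> ideal_gen tensor_relators"
  shows "semilin id f p = semilin id f q"
proof -
  have base: "semilin id f (a * r * b) = 0" if "r \<in> tensor_relators" for a r b
  proof (induction a rule: poly_mapping_induct)
    case (single m c)
    show ?case
    proof (induction b rule: poly_mapping_induct)
      case (single n d)
      show ?case using that
        by cases (simp_all add: f_def ring_distribs mult_single plus_tpair_def zero_tpair_def semilin_add
            semilin_diff antipode_add antipode_mult antipode_cscale cscale_mult_left cscale_mult_right
            cscale_cscale cscale_add_right mult.commute mult.left_commute mult.assoc)
    qed (simp add: distrib_left semilin_add)
  qed (simp add: distrib_right semilin_add)
  have "semilin id f (p - q) = 0"
    using assms(2) by induction (simp_all only: semilin_zero semilin_add[OF scalar_hom_id] base add_0_left)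
  then show ?thesis by (simp add: semilin_diff)
qed

text \<open>\<open>sandwich t x\<close> is \<open>\<Sum> a x S(b)\<close> for \<open>t = \<Sum> a \<otimes> b\<close>.\<close>

lift_definition sandwich :: "H1i_tensor \<Rightarrow> H1i \<Rightarrow> H1i"
  is "\<lambda>t x. semilin id (\<lambda>m. tleft m * x * antipode (tright m)) t"
  by (rule ext, rule sandwich_relators)

lemma sandwich_tensor: "sandwich (a \<otimes> b) x = a * x * antipode b"
  by transfer (simp add: cscale_one)

lemma sandwich_add: "sandwich (s + t) x = sandwich s x + sandwich t x"
  and sandwich_cscale: "sandwich (c *\<^sub>C t) x = c *\<^sub>C sandwich t x"
  by (transfer, rule semilin_id_hom)+

lemma sandwich_add_right: "sandwich t (x + y) = sandwich t x + sandwich t y"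
proof (transfer fixing: x y)
  fix t :: "tpair \<Rightarrow>\<^sub>0 complex"
  show "semilin id (\<lambda>m. tleft m * (x + y) * antipode (tright m)) t
    = semilin id (\<lambda>m. tleft m * x * antipode (tright m)) t + semilin id (\<lambda>m. tleft m * y * antipode (tright m)) t"
    by (simp add: semilin_def distrib_left distrib_right cscale_add_right sum.distrib)
qed

lemma sandwich_cscale_right: "sandwich t (c *\<^sub>C x) = c *\<^sub>C sandwich t x"
proof (transfer fixing: x c)
  fix t :: "tpair \<Rightarrow>\<^sub>0 complex"
  show "semilin id (\<lambda>m. tleft m * (c *\<^sub>C x) * antipode (tright m)) t
    = c *\<^sub>C semilin id (\<lambda>m. tleft m * x * antipode (tright m)) t"
    by (simp add: semilin_def cscale_mult_left cscale_mult_right cvec.scale_sum_right cscale_cscale mult.commute)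
qed

lemma sandwich_mult: "sandwich (s * t) x = sandwich s (sandwich t x)"
proof -
  have s: "\<exists>p. s = abs_H1i_tensor p" for s by (metis Quotient_H1i_tensor Quotient_abs_rep)
  have sgl: "abs_H1i_tensor (Poly_Mapping.single m c) = c *\<^sub>C (tleft m \<otimes> tright m)" for m c
    by (simp add: cscale_H1i_tensor.abs_eq tensor.abs_eq mult_single)
  obtain p q where pq: "s = abs_H1i_tensor p" "t = abs_H1i_tensor q" using s by metis
  have "sandwich (abs_H1i_tensor p * abs_H1i_tensor q) x
      = sandwich (abs_H1i_tensor p) (sandwich (abs_H1i_tensor q) x)"
  proof (induction p rule: poly_mapping_induct)
    case (single m c)
    show ?case
    proof (induction q rule: poly_mapping_induct)
      case (single n d)
      show ?case
        by (simp add: sgl cscale_mult_left cscale_mult_right tensor_mult sandwich_cscale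
            sandwich_tensor antipode_mult cscale_cscale mult.assoc)
    qed (simp add: plus_H1i_tensor.abs_eq[symmetric] distrib_left sandwich_add sandwich_add_right)
  qed (simp add: plus_H1i_tensor.abs_eq[symmetric] distrib_right sandwich_add)
  then show ?thesis by (simp add: pq)
qed

definition adj_rep :: "H1i \<Rightarrow> H1i \<Rightarrow> H1i"  (\<open>\<mu>\<close>)
  where "\<mu> a x = sandwich (Delta a) x"

lemma mu_add: "\<mu> (a + b) x = \<mu> a x + \<mu> b x" "\<mu> a (x + y) = \<mu> a x + \<mu> a y"
  and mu_cscale: "\<mu> (c *\<^sub>C a) x = c *\<^sub>C \<mu> a x" "\<mu> a (c *\<^sub>C x) = c *\<^sub>C \<mu> a x"
proof -
  show "\<mu> (a + b) x = \<mu> a x + \<mu> b x" "\<mu> (c *\<^sub>C a) x = c *\<^sub>C \<mu> a x"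
    using Delta_hom by (simp_all add: adj_rep_def algebra_hom_def sandwich_add sandwich_cscale)
  show "\<mu> a (x + y) = \<mu> a x + \<mu> a y" "\<mu> a (c *\<^sub>C x) = c *\<^sub>C \<mu> a x"
    unfolding adj_rep_def by (rule sandwich_add_right sandwich_cscale_right)+
qed

lemma mu_one: "\<mu> 1 x = x"
  using Delta_hom by (simp add: adj_rep_def algebra_hom_def tensor_one[symmetric] sandwich_tensor antipode_one)

lemma mu_mult: "\<mu> (a * b) x = \<mu> a (\<mu> b x)"
  using Delta_hom by (simp add: adj_rep_def algebra_hom_def sandwich_mult)

definition Tr_mu :: "H1i \<Rightarrow> complex"
  where "Tr_mu a = cvec.ltrace (\<mu> a)"

definition scalar_prod :: "H1i \<Rightarrow> H1i \<Rightarrow> complex"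
  where "scalar_prod a b = 1 / 4 * Tr_mu (star a * b)"

section \<open>The basis and the nilradical\<close>

definition e0 :: H1i where "e0 = (1 / 2) *\<^sub>C (1 + HK)"
definition e1 :: H1i where "e1 = (1 / 2) *\<^sub>C (1 - HK)"
definition E0 :: H1i where "E0 = e0 * HE"
definition E1 :: H1i where "E1 = e1 * HE"
definition F0 :: H1i where "F0 = e0 * HF"
definition F1 :: H1i where "F1 = e1 * HF"
definition C0 :: H1i where "C0 = e0 * HE * HF"
definition C1 :: H1i where "C1 = e1 * HE * HF"

definition H1i_basis :: "H1i list"
  where "H1i_basis = [e0, e1, E0, E1, F0, F1, C0, C1]"

definition N1 :: "H1i set"
  where "N1 = cvec.span {E0, E1, F0, F1, C0, C1}"

lemma H1i_induct [case_names one add cscale K E F]: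
  assumes one: "P 1" and add: "\<And>x y. P x \<Longrightarrow> P y \<Longrightarrow> P (x + y)" and cscale: "\<And>c x. P x \<Longrightarrow> P (c *\<^sub>C x)"
    and K: "\<And>x. P x \<Longrightarrow> P (HK * x)" and E: "\<And>x. P x \<Longrightarrow> P (HE * x)" and F: "\<And>x. P x \<Longrightarrow> P (HF * x)"
  shows "P x"
proof -
  have w: "P (abs_H1i (Poly_Mapping.single (Word gs) 1))" for gs
  proof (induction gs)
    case Nil
    then show ?case
      using one by (simp add: one_H1i_def single_one[symmetric] zero_gen_word_def)
  next
    case (Cons g gs)
    have "abs_H1i (Poly_Mapping.single (Word (g # gs)) 1)
        = abs_H1i (free_gen g) * abs_H1i (Poly_Mapping.single (Word gs) 1)"
      by (simp add: times_H1i.abs_eq free_gen_def mult_single plus_gen_word_def)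
    then show ?case using K[OF Cons] E[OF Cons] F[OF Cons]
      by (cases g) (simp_all add: HK_def HE_def HF_def)
  qed
  have "P (abs_H1i p)" for p
  proof (induction p rule: poly_mapping_induct)
    case (single m c)
    have "abs_H1i (Poly_Mapping.single m c) = c *\<^sub>C abs_H1i (Poly_Mapping.single (Word (letters m)) 1)"
      by (simp add: cscale_H1i.abs_eq mult_single)
    then show ?case using cscale[OF w, of c "letters m"] by simp
  next
    case (add p q)
    then show ?case using assms(2) by (simp add: plus_H1i.abs_eq[symmetric])
  qed
  then show ?thesis by (metis Quotient_H1i Quotient_abs_rep)
qed

lemmas H1i_nf = e0_def e1_def E0_def E1_def F0_def F1_def C0_def C1_def distrib_left distrib_right
  left_diff_distrib right_diff_distrib cscale_mult_left cscale_mult_right cscale_add_right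
  cscale_minus_simps mult.assoc H1i_relations H1i_relations_assoc

lemma H1i_gen_mult_left:
  "HK * e0 = e0" "HK * e1 = - e1" "HK * E0 = E0" "HK * E1 = - E1" "HK * F0 = F0" "HK * F1 = - F1"
  "HK * C0 = C0" "HK * C1 = - C1"
  "HE * e0 = E1" "HE * e1 = E0" "HE * E0 = 0" "HE * E1 = 0" "HE * F0 = C1" "HE * F1 = C0"
  "HE * C0 = 0" "HE * C1 = 0"
  "HF * e0 = F1" "HF * e1 = F0" "HF * E0 = C1" "HF * E1 = C0" "HF * F0 = 0" "HF * F1 = 0"
  "HF * C0 = 0" "HF * C1 = 0"
  by (simp_all add: H1i_nf)

lemma H1i_gen_mult_right:
  "e0 * HK = e0" "e1 * HK = - e1" "E0 * HK = - E0" "E1 * HK = E1" "F0 * HK = - F0" "F1 * HK = F1"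
  "C0 * HK = C0" "C1 * HK = - C1"
  "e0 * HE = E0" "e1 * HE = E1" "E0 * HE = 0" "E1 * HE = 0" "F0 * HE = C0" "F1 * HE = C1"
  "C0 * HE = 0" "C1 * HE = 0"
  "e0 * HF = F0" "e1 * HF = F1" "E0 * HF = C0" "E1 * HF = C1" "F0 * HF = 0" "F1 * HF = 0"
  "C0 * HF = 0" "C1 * HF = 0"
  by (simp_all add: H1i_nf)

lemma N1_subspace: "cvec.subspace N1"
  by (simp add: N1_def cvec.subspace_span)

lemmas N1_closed = cvec.subspace_0[OF N1_subspace] cvec.subspace_add[OF N1_subspace]
  cvec.subspace_diff[OF N1_subspace] cvec.subspace_neg[OF N1_subspace] cvec.subspace_scale[OF N1_subspace]

lemma N1_base: "E0 \<in> N1" "E1 \<in> N1" "F0 \<in> N1" "F1 \<in> N1" "C0 \<in> N1" "C1 \<in> N1"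
  by (simp_all add: N1_def cvec.span_base)

lemma N1_induct [consumes 1, case_names zero add base]:
  assumes "x \<in> N1" and "P 0" and "\<And>x y. P x \<Longrightarrow> P y \<Longrightarrow> P (x + y)"
    and "\<And>c. P (c *\<^sub>C E0)" "\<And>c. P (c *\<^sub>C E1)" "\<And>c. P (c *\<^sub>C F0)" "\<And>c. P (c *\<^sub>C F1)"
      "\<And>c. P (c *\<^sub>C C0)" "\<And>c. P (c *\<^sub>C C1)"
  shows "P x"
  using assms(1) unfolding N1_def
  by (induction rule: cvec.span_induct_alt) (use assms in auto)

lemma N1_gen_left: "x \<in> N1 \<Longrightarrow> HK * x \<in> N1 \<and> HE * x \<in> N1 \<and> HF * x \<in> N1"
  by (induction rule: N1_induct)
    (simp_all add: distrib_left cscale_mult_right cscale_minus_simps H1i_gen_mult_left N1_closed N1_base)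

lemma N1_gen_right: "x \<in> N1 \<Longrightarrow> x * HK \<in> N1 \<and> x * HE \<in> N1 \<and> x * HF \<in> N1"
  by (induction rule: N1_induct)
    (simp_all add: distrib_right cscale_mult_left cscale_minus_simps H1i_gen_mult_right N1_closed N1_base)

lemma N1_mult_left: "x \<in> N1 \<Longrightarrow> a * x \<in> N1"
  by (induction a rule: H1i_induct)
    (simp_all add: distrib_right cscale_mult_left N1_closed N1_gen_left mult.assoc)

lemma N1_mult_right: "x \<in> N1 \<Longrightarrow> x * a \<in> N1"
  by (induction a arbitrary: x rule: H1i_induct)
    (simp_all add: distrib_left cscale_mult_right N1_closed N1_gen_right mult.assoc[symmetric])

lemma N1_two_sided_ideal: "two_sided_ideal N1"
  by (simp add: two_sided_ideal_def N1_subspace N1_mult_left N1_mult_right)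

lemma H1i_decomp: "\<exists>\<alpha> \<beta> n. n \<in> N1 \<and> x = \<alpha> *\<^sub>C e0 + \<beta> *\<^sub>C e1 + n"
proof (induction x rule: H1i_induct)
  case one
  have "e0 + e1 = (1 / 2) *\<^sub>C (1 + HK + (1 - HK))"
    unfolding e0_def e1_def by (rule cscale_add_right[symmetric])
  also have "\<dots> = (1 / 2) *\<^sub>C 1 + (1 / 2) *\<^sub>C 1" by (simp add: cscale_add_right[symmetric])
  also have "\<dots> = (1 / 2 + 1 / 2) *\<^sub>C 1" by (rule cscale_add_left[symmetric])
  finally have "(1::H1i) = 1 *\<^sub>C e0 + 1 *\<^sub>C e1 + 0" by (simp add: cscale_one)
  then show ?case using N1_closed(1) by blast
next
  case (add x y)
  then obtain a b n a' b' n' where "n \<in> N1" "x = a *\<^sub>C e0 + b *\<^sub>C e1 + n" "n' \<in> N1" "y = a' *\<^sub>C e0 + b' *\<^sub>C e1 + n'"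
    by blast
  then have "n + n' \<in> N1 \<and> x + y = (a + a') *\<^sub>C e0 + (b + b') *\<^sub>C e1 + (n + n')"
    by (simp add: N1_closed cscale_add_left algebra_simps)
  then show ?case by blast
next
  case (cscale c x)
  then obtain a b n where "n \<in> N1" "x = a *\<^sub>C e0 + b *\<^sub>C e1 + n" by blast
  then have "c *\<^sub>C n \<in> N1 \<and> c *\<^sub>C x = (c * a) *\<^sub>C e0 + (c * b) *\<^sub>C e1 + c *\<^sub>C n"
    by (simp add: N1_closed cscale_add_right cscale_cscale)
  then show ?case by blast
next
  case (K x)
  then obtain a b n where "n \<in> N1" "x = a *\<^sub>C e0 + b *\<^sub>C e1 + n" by blast
  then have "HK * n \<in> N1 \<and> HK * x = a *\<^sub>C e0 + (- b) *\<^sub>C e1 + HK * n"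
    by (simp add: N1_gen_left distrib_left cscale_mult_right H1i_gen_mult_left cscale_minus_simps)
  then show ?case by blast
next
  case (E x)
  then obtain a b n where "n \<in> N1" "x = a *\<^sub>C e0 + b *\<^sub>C e1 + n" by blast
  then have "HE * x \<in> N1"
    by (simp add: N1_gen_left distrib_left cscale_mult_right H1i_gen_mult_left N1_closed N1_base)
  then have "HE * x \<in> N1 \<and> HE * x = 0 *\<^sub>C e0 + 0 *\<^sub>C e1 + HE * x" by (simp add: cscale_minus_simps)
  then show ?case by blast
next
  case (F x)
  then obtain a b n where "n \<in> N1" "x = a *\<^sub>C e0 + b *\<^sub>C e1 + n" by blast
  then have "HF * x \<in> N1"
    by (simp add: N1_gen_left distrib_left cscale_mult_right H1i_gen_mult_left N1_closed N1_base)
  then have "HF * x \<in> N1 \<and> HF * x = 0 *\<^sub>C e0 + 0 *\<^sub>C e1 + HF * x" by (simp add: cscale_minus_simps)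
  then show ?case by blast
qed

lemma H1i_twist: "\<exists>q. p * HE = HE * q \<and> p * HF = HF * q"
proof (induction p rule: H1i_induct)
  case one
  show ?case by (rule exI[of _ 1]) simp
next
  case (add x y)
  then show ?case by (metis distrib_left distrib_right)
next
  case (cscale c x)
  then show ?case by (metis cscale_mult_left cscale_mult_right)
next
  case (K x)
  then obtain q where "x * HE = HE * q \<and> x * HF = HF * q" by blast
  then show ?case
    by (intro exI[of _ "- (HK * q)"]) (simp add: mult.assoc H1i_relations_assoc)
next
  case (E x)
  then obtain q where "x * HE = HE * q \<and> x * HF = HF * q" by blast
  then show ?case
    by (intro exI[of _ "HE * q"]) (simp add: mult.assoc H1i_relations_assoc)
next
  case (F x)
  then obtain q where "x * HE = HE * q \<and> x * HF = HF * q" by blast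
  then show ?case
    by (intro exI[of _ "HF * q"]) (simp add: mult.assoc H1i_relations_assoc)
qed

lemma N1_nilpotent:
  assumes "x \<in> N1"
  shows "x ^ 3 = 0"
proof -
  have base: "c *\<^sub>C E0 = HE * (c *\<^sub>C e1) + HF * 0" "c *\<^sub>C E1 = HE * (c *\<^sub>C e0) + HF * 0"
    "c *\<^sub>C F0 = HE * 0 + HF * (c *\<^sub>C e1)" "c *\<^sub>C F1 = HE * 0 + HF * (c *\<^sub>C e0)"
    "c *\<^sub>C C0 = HE * (c *\<^sub>C F1) + HF * 0" "c *\<^sub>C C1 = HE * (c *\<^sub>C F0) + HF * 0" for c
    by (simp_all add: cscale_mult_right H1i_gen_mult_left)
  have "\<exists>p q. x = HE * p + HF * q"
  proof (rule N1_induct[OF assms, where P = "\<lambda>x. \<exists>p q. x = HE * p + HF * q"])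
    show "\<exists>p q. 0 = HE * p + HF * q" by (rule exI[of _ 0], rule exI[of _ 0]) simp
    show "\<exists>p q. x + y = HE * p + HF * q"
      if "\<exists>p q. x = HE * p + HF * q" "\<exists>p q. y = HE * p + HF * q" for x y
    proof -
      from that obtain p q p' q' where "x = HE * p + HF * q" "y = HE * p' + HF * q'" by blast
      then have "x + y = HE * (p + p') + HF * (q + q')" by (simp add: algebra_simps)
      then show ?thesis by blast
    qed
  qed (use base in blast)+
  then obtain p q where x: "x = HE * p + HF * q" by blast
  obtain p' q' where tw: "p * HE = HE * p'" "p * HF = HF * p'" "q * HE = HE * q'" "q * HF = HF * q'"
    using H1i_twist by metis
  obtain p'' q'' where tw': "p' * HE = HE * p''" "p' * HF = HF * p''" "q' * HE = HE * q''" "q' * HF = HF * q''"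
    using H1i_twist by metis
  have tws: "p * (HE * z) = HE * (p' * z)" "p * (HF * z) = HF * (p' * z)"
    "q * (HE * z) = HE * (q' * z)" "q * (HF * z) = HF * (q' * z)"
    "p' * (HE * z) = HE * (p'' * z)" "p' * (HF * z) = HF * (p'' * z)"
    "q' * (HE * z) = HE * (q'' * z)" "q' * (HF * z) = HF * (q'' * z)" for z
    by (simp_all only: mult.assoc[symmetric] tw tw')
  show ?thesis
    unfolding x by (simp add: power3_eq_cube distrib_left distrib_right mult.assoc tws H1i_relations_assoc)
qed

lift_definition sign_char :: "H1i \<Rightarrow> complex"
  is "semilin id (word_hom (\<lambda>g. case g of GK \<Rightarrow> - 1 | GE \<Rightarrow> 0 | GF \<Rightarrow> 0))"
  by (rule word_hom_relators[OF scalar_hom_id]) simp_all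

lemma sign_char_hom: "algebra_hom sign_char"
  unfolding algebra_hom_def
proof (intro conjI allI)
  show "sign_char 1 = 1" by transfer (simp add: semilin_one word_hom_def zero_gen_word_def)
  show "sign_char (x + y) = sign_char x + sign_char y" for x y by transfer (rule semilin_id_hom)
  show "sign_char (x * y) = sign_char x * sign_char y" for x y
    by transfer (rule semilin_mult[OF scalar_hom_id word_hom_plus])
  show "sign_char (c *\<^sub>C x) = c *\<^sub>C sign_char x" for c x by transfer (rule semilin_id_hom)
qed

lemma sign_char_values: "sign_char HK = - 1" "sign_char HE = 0" "sign_char HF = 0"
  using sign_char.abs_eq[of "free_gen GK"] sign_char.abs_eq[of "free_gen GE"] sign_char.abs_eq[of "free_gen GF"]
  by (simp_all add: H1i_gens semilin_free_gen)

lemma H1i_char: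
  fixes \<chi> :: "H1i \<Rightarrow> complex"
  assumes "algebra_hom \<chi>" "\<chi> HE = 0" "\<chi> HF = 0" "n \<in> N1"
  shows "\<chi> (a *\<^sub>C e0 + b *\<^sub>C e1 + n) = a * \<chi> e0 + b * \<chi> e1"
    and "\<chi> e0 = (1 + \<chi> HK) / 2" and "\<chi> e1 = (1 - \<chi> HK) / 2"
    and "x ^ k = 0 \<Longrightarrow> \<chi> x = 0"
proof -
  have h: "\<chi> 1 = 1" "\<chi> (x + y) = \<chi> x + \<chi> y" "\<chi> (x * y) = \<chi> x * \<chi> y" "\<chi> (c *\<^sub>C x) = c * \<chi> x" for x y c
    using assms(1) by (simp_all add: algebra_hom_def cscale_complex_def)
  have h0: "\<chi> 0 = 0" using h(2)[of 0 0] by simp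
  have hm: "\<chi> (- x) = - \<chi> x" for x using h(2)[of x "- x"] h0 by (simp add: eq_neg_iff_add_eq_0 add.commute)
  have hd: "\<chi> (x - y) = \<chi> x - \<chi> y" for x y using h(2)[of x "- y"] hm by simp
  have "\<chi> n = 0"
    by (rule N1_induct[OF assms(4), where P = "\<lambda>n. \<chi> n = 0"])
      (simp_all add: h h0 E0_def E1_def F0_def F1_def C0_def C1_def assms)
  then show "\<chi> (a *\<^sub>C e0 + b *\<^sub>C e1 + n) = a * \<chi> e0 + b * \<chi> e1" by (simp add: h)
  show "\<chi> e0 = (1 + \<chi> HK) / 2" "\<chi> e1 = (1 - \<chi> HK) / 2" by (simp_all add: e0_def e1_def h hd)
  have "\<chi> (x ^ k) = \<chi> x ^ k" by (induction k) (simp_all add: h)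
  then show "x ^ k = 0 \<Longrightarrow> \<chi> x = 0" using h0 by simp
qed

lemma N1_eq_nilradical: "N1 = nilradical"
proof
  show "N1 \<subseteq> nilradical"
    unfolding nilradical_def using N1_two_sided_ideal N1_nilpotent by blast
  show "nilradical \<subseteq> N1"
  proof
    fix x :: H1i
    assume "x \<in> nilradical"
    then obtain k where k: "x ^ k = 0" unfolding nilradical_def by blast
    obtain a b n where n: "n \<in> N1" and x: "x = a *\<^sub>C e0 + b *\<^sub>C e1 + n" using H1i_decomp by blast
    note c = H1i_char[OF counit_hom counit_values(2,3) n] and s = H1i_char[OF sign_char_hom sign_char_values(2,3) n]
    have "counit x = a" "sign_char x = b"
      unfolding x c(1) s(1) c(2,3) s(2,3) counit_values sign_char_values by simp_all
    then have "a = 0" "b = 0" using c(4)[OF k] s(4)[OF k] by simp_all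
    then show "x \<in> N1" using n x by (simp add: cscale_minus_simps)
  qed
qed

quotient_type H1i_ss = H1i / "\<lambda>x y. x - y \<in> N1"
proof (rule equivpI)
  show "reflp (\<lambda>x y. x - y \<in> N1)" by (simp add: reflp_def N1_closed)
  show "symp (\<lambda>x y. x - y \<in> N1)" unfolding symp_def using N1_closed(4) by (metis minus_diff_eq)
  show "transp (\<lambda>x y. x - y \<in> N1)"
    unfolding transp_def using N1_closed(2) by (metis diff_add_cancel add_diff_eq)
qed

lemma N1_diff_closed:
  assumes "x - x' \<in> N1"
  shows "y - y' \<in> N1 \<Longrightarrow> x + y - (x' + y') \<in> N1"
    and "y - y' \<in> N1 \<Longrightarrow> x - y - (x' - y') \<in> N1"
    and "y - y' \<in> N1 \<Longrightarrow> x * y - x' * y' \<in> N1"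
    and "- x - - x' \<in> N1" and "c *\<^sub>C x - c *\<^sub>C x' \<in> N1"
proof -
  show "x + y - (x' + y') \<in> N1" if "y - y' \<in> N1"
    using N1_closed(2)[OF assms that] by (simp add: algebra_simps)
  show "x - y - (x' - y') \<in> N1" if "y - y' \<in> N1"
    using N1_closed(3)[OF assms that] by (simp add: algebra_simps)
  show "x * y - x' * y' \<in> N1" if "y - y' \<in> N1"
  proof -
    have "x * y - x' * y' = (x - x') * y + x' * (y - y')" by (simp add: algebra_simps)
    then show ?thesis using assms that by (simp add: N1_closed N1_mult_left N1_mult_right)
  qed
  show "- x - - x' \<in> N1" using N1_closed(4)[OF assms] by (simp add: algebra_simps)
  show "c *\<^sub>C x - c *\<^sub>C x' \<in> N1" using N1_closed(5)[OF assms, of c] by (simp add: cscale_minus_simps)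
qed

lemma N1_diff_eq: "x = y \<Longrightarrow> x - y \<in> N1"
  by (simp add: N1_closed)

instantiation H1i_ss :: complex_algebra
begin
lift_definition zero_H1i_ss :: H1i_ss is 0 .
lift_definition one_H1i_ss :: H1i_ss is 1 .
lift_definition plus_H1i_ss :: "H1i_ss \<Rightarrow> H1i_ss \<Rightarrow> H1i_ss" is "(+)"
  by (rule N1_diff_closed(1))
lift_definition minus_H1i_ss :: "H1i_ss \<Rightarrow> H1i_ss \<Rightarrow> H1i_ss" is "(-)"
  by (rule N1_diff_closed(2))
lift_definition uminus_H1i_ss :: "H1i_ss \<Rightarrow> H1i_ss" is uminus
  by (rule N1_diff_closed(4))
lift_definition times_H1i_ss :: "H1i_ss \<Rightarrow> H1i_ss \<Rightarrow> H1i_ss" is "(*)"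
  by (rule N1_diff_closed(3))
lift_definition cscale_H1i_ss :: "complex \<Rightarrow> H1i_ss \<Rightarrow> H1i_ss" is "(*\<^sub>C)"
  by (rule N1_diff_closed(5))
instance
  by standard
    (transfer, rule N1_diff_eq,
      simp add: algebra_simps cscale_add_right cscale_add_left cscale_cscale cscale_one cscale_mult_left
        cscale_mult_right)+
end

definition ss_proj :: "H1i \<Rightarrow> H1i_ss" where "ss_proj = abs_H1i_ss"

text \<open>Sesquilinear forms here are antilinear in the first argument and linear in the second; antilinearity
  follows from Hermitian symmetry.\<close>

definition pos_semidef_form :: "('a::complex_algebra \<Rightarrow> 'a \<Rightarrow> complex) \<Rightarrow> bool"
  where "pos_semidef_form B \<longleftrightarrow> (\<forall>a b c. B a (b + c) = B a b + B a c) \<and> (\<forall>a s b. B a (s *\<^sub>C b) = s * B a b)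
    \<and> (\<forall>a b. B b a = cnj (B a b)) \<and> (\<forall>a. B a a \<in> \<real> \<and> 0 \<le> Re (B a a))"

text \<open>The kernel of the form; for a positive semi-definite form it coincides with the set of all
  \<open>a\<close> such that \<open>B a a = 0\<close>.\<close>

definition null_space :: "('a::complex_algebra \<Rightarrow> 'a \<Rightarrow> complex) \<Rightarrow> 'a set"
  where "null_space B = {a. \<forall>b. B a b = 0}"

end

theory Submission
  imports Defs
begin

text \<open>The generators act on the basis vectors by explicit formulas, so the values of \<open>\<mu>\<close> are a
  direct computation. The trace needs the linear independence of the eight elements, which is read
  off from the regular representation. The algebra has two characters, \<open>counit\<close> and \<open>sign_char\<close>,
  both killing \<open>N1\<close>, and comparing values on \<open>e0\<close>, \<open>e1\<close> and \<open>N1\<close> gives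
  \<open>Tr_mu a = 4 (counit a + sign_char a)\<close>. Both characters are compatible with \<open>star\<close>, so the scalar
  product is \<open>cnj (counit a) counit b + cnj (sign_char a) sign_char b\<close>.\<close>

section \<open>Linear independence\<close>

text \<open>Operators are composed through their effect on a vector; \<open>foldr\<close> lets the
  rightmost letter act first, which makes this a left action.\<close>

definition word_act :: "(gen \<Rightarrow> 'v \<Rightarrow> 'v) \<Rightarrow> gen_word \<Rightarrow> 'v \<Rightarrow> 'v"
  where "word_act A w v = foldr A (letters w) v"

lemma word_act_plus: "word_act A (u + w) v = word_act A u (word_act A w v)"
  by (simp add: word_act_def plus_gen_word_def)

lemma word_act_linear:
  assumes "\<And>g x y. A g (x + y) = A g x + A g y" "\<And>g c x. A g (c *\<^sub>C x) = c *\<^sub>C A g x"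
  shows "word_act A w (x + y) = word_act A w x + word_act A w y"
    and "word_act A w (c *\<^sub>C x) = c *\<^sub>C word_act A w (x :: 'v::complex_algebra)"
proof -
  have "foldr A gs (x + y) = foldr A gs x + foldr A gs y \<and> foldr A gs (c *\<^sub>C x) = c *\<^sub>C foldr A gs x" for gs
    by (induction gs) (simp_all add: assms)
  then show "word_act A w (x + y) = word_act A w x + word_act A w y"
    "word_act A w (c *\<^sub>C x) = c *\<^sub>C word_act A w x"
    by (simp_all add: word_act_def)
qed

definition free_act :: "(gen \<Rightarrow> 'v \<Rightarrow> 'v) \<Rightarrow> (gen_word \<Rightarrow>\<^sub>0 complex) \<Rightarrow> 'v \<Rightarrow> 'v::complex_algebra"
  where "free_act A p v = semilin id (\<lambda>w. word_act A w v) p"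

lemma free_act_cscale:
  assumes "\<And>g x y. A g (x + y) = A g x + A g y" "\<And>g c x. A g (c *\<^sub>C x) = c *\<^sub>C A g x"
  shows "free_act A p (c *\<^sub>C x) = c *\<^sub>C free_act A p x"
  by (simp add: free_act_def semilin_def word_act_linear[of A, OF assms] cvec.scale_sum_right cscale_cscale
      mult.commute)

text \<open>Linearity of the operators enters because the inner action already yields a linear
  combination of vectors.\<close>

lemma free_act_mult:
  assumes "\<And>g x y. A g (x + y) = A g x + A g y" "\<And>g c x. A g (c *\<^sub>C x) = c *\<^sub>C A g x"
  shows "free_act A (p * q) v = free_act A p (free_act A q v)"
proof (induction p rule: poly_mapping_induct)
  case (single m c)
  show ?case
  proof (induction q rule: poly_mapping_induct)
    case (single n d)
    show ?case
      by (simp add: free_act_def mult_single word_act_plus word_act_linear[of A, OF assms] cscale_cscale)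
  qed (simp_all add: free_act_def distrib_left semilin_add word_act_linear[of A, OF assms] cscale_add_right)
qed (simp add: free_act_def distrib_right semilin_add)

lemma free_act_gen: "free_act A (free_gen g) v = A g v"
  by (simp add: free_act_def free_gen_def word_act_def cscale_one)

lemma free_act_add: "free_act A (p + q) v = free_act A p v + free_act A q v"
  and free_act_diff: "free_act A (p - q) v = free_act A p v - free_act A q v"
  and free_act_scale: "free_act A (Poly_Mapping.single 0 c * p) v = c *\<^sub>C free_act A p v"
  and free_act_one: "free_act A 1 v = v"
  unfolding free_act_def
  by (simp_all add: semilin_add semilin_diff semilin_scale semilin_one)
    (simp add: word_act_def zero_gen_word_def)

text \<open>Left multiplication in the basis \<open>1, E, F, EF\<close> of the algebra as a right module over the
  group algebra of \<open>K\<close>, the latter identified with \<open>complex \<times> complex\<close> through its two characters.\<close>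

type_synonym reg_vec = "(complex \<times> complex) \<times> (complex \<times> complex) \<times> (complex \<times> complex) \<times> (complex \<times> complex)"

text \<open>The components are the coefficients of \<open>1, E, F, EF\<close>, in this order. Moving
  \<open>K\<close> past \<open>E\<close> or \<open>F\<close> costs a sign, whence
  \<open>(- 1, 1)\<close> in the middle; on \<open>EF\<close> the two signs cancel.\<close>

fun reg_gen :: "gen \<Rightarrow> reg_vec \<Rightarrow> reg_vec"
  where "reg_gen GK (a, b, c, d) = ((1, - 1) * a, (- 1, 1) * b, (- 1, 1) * c, (1, - 1) * d)"
  | "reg_gen GE (a, b, c, d) = (0, a, 0, c)"
  | "reg_gen GF (a, b, c, d) = (0, 0, a, b)"

lemma reg_gen_linear:
  "reg_gen g (x + y) = reg_gen g x + reg_gen g y"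
  "reg_gen g (c *\<^sub>C x) = c *\<^sub>C reg_gen g x"
  by (cases g; cases x; cases y;
      simp add: cscale_prod_def cscale_complex_def times_prod_def zero_prod_def)+

lemmas reg_act_mult = free_act_mult[of reg_gen, OF reg_gen_linear]

lemma reg_act_zero: "free_act reg_gen p 0 = 0"
  using free_act_cscale[of reg_gen p 0 0, OF reg_gen_linear] by (simp add: cscale_minus_simps)

lemma reg_act_relator: "r \<in> H1i_relators \<Longrightarrow> free_act reg_gen r v = 0"
  by (cases v) (auto simp: H1i_relators_def Let_def free_act_add free_act_diff free_act_one reg_act_mult
      free_act_gen times_prod_def zero_prod_def)

text \<open>A relator annihilates every vector, not just \<open>(1, 0, 0, 0)\<close>, so it still
  acts as zero between arbitrary factors.\<close>

lemma reg_act_ideal: "x \<in> ideal_gen H1i_relators \<Longrightarrow> free_act reg_gen x v = 0"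
proof (induction rule: ideal_gen.induct)
  case ideal_zero
  show ?case by (simp add: free_act_def)
qed (simp_all add: free_act_add reg_act_mult reg_act_relator reg_act_zero)

text \<open>The image under \<open>x\<close> of the vector that stands for \<open>1\<close>, hence
  the coordinates of \<open>x\<close> itself in the regular module.\<close>

lift_definition coords :: "H1i \<Rightarrow> reg_vec" is "\<lambda>p. free_act reg_gen p (1, 0, 0, 0)"
  by (metis reg_act_ideal free_act_diff eq_iff_diff_eq_0)

lemma coords_one: "coords 1 = (1, 0, 0, 0)"
  by transfer (rule free_act_one)

lemma coords_add: "coords (x + y) = coords x + coords y"
  by transfer (rule free_act_add)

lemma coords_cscale: "coords (c *\<^sub>C x) = c *\<^sub>C coords x"
  by transfer (rule free_act_scale)

lemma coords_zero: "coords 0 = 0"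
  using coords_cscale[of 0 0] by (simp add: cscale_minus_simps)

lemma coords_diff: "coords (x - y) = coords x - coords y"
  using coords_add[of "x - y" y] by simp

lemma coords_gen: "coords (HK * x) = reg_gen GK (coords x)" "coords (HE * x) = reg_gen GE (coords x)"
  "coords (HF * x) = reg_gen GF (coords x)"
  by (transfer, simp add: reg_act_mult free_act_gen)+

lemma coords_basis:
  "coords e0 = ((1, 0), 0, 0, 0)" "coords e1 = ((0, 1), 0, 0, 0)"
  "coords E0 = (0, (0, 1), 0, 0)" "coords E1 = (0, (1, 0), 0, 0)"
  "coords F0 = (0, 0, (0, 1), 0)" "coords F1 = (0, 0, (1, 0), 0)"
  "coords C0 = (0, 0, 0, (1, 0))" "coords C1 = (0, 0, 0, (0, 1))"
proof -
  have K: "coords HK = ((1, - 1), 0, 0, 0)"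
    using coords_gen(1)[of 1] by (simp add: coords_one times_prod_def one_prod_def zero_prod_def)
  show e: "coords e0 = ((1, 0), 0, 0, 0)" "coords e1 = ((0, 1), 0, 0, 0)"
    by (simp_all add: e0_def e1_def coords_add coords_diff coords_cscale K coords_one
        cscale_prod_def cscale_complex_def one_prod_def zero_prod_def)
  show E: "coords E0 = (0, (0, 1), 0, 0)" "coords E1 = (0, (1, 0), 0, 0)"
    "coords F0 = (0, 0, (0, 1), 0)" "coords F1 = (0, 0, (1, 0), 0)"
    \<comment> \<open>\<open>E0 = HE * e1\<close> and its three analogues move the idempotent to the
      right; this is why the index flips.\<close>
    by (simp_all flip: H1i_gen_mult_left(9,10,17,18) add: coords_gen e)
  show "coords C0 = (0, 0, 0, (1, 0))" "coords C1 = (0, 0, 0, (0, 1))"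
    by (simp_all flip: H1i_gen_mult_left(13,14) add: coords_gen E)
qed

section \<open>The eight elements as a basis\<close>

lemma distinct_basis: "distinct H1i_basis"
proof -
  have "distinct (map coords H1i_basis)"
    by (simp add: H1i_basis_def coords_basis zero_prod_def)
  then show ?thesis by (simp add: distinct_map)
qed

lemma sum_basis:
  "(\<Sum>b\<in>set H1i_basis. f b) = f e0 + (f e1 + (f E0 + (f E1 + (f F0 + (f F1 + (f C0 + f C1))))))"
  for f :: "H1i \<Rightarrow> 'b::comm_monoid_add"
  unfolding sum.distinct_set_conv_list[OF distinct_basis] by (simp add: H1i_basis_def)

lemma independent_basis: "cvec.independent (set H1i_basis)"
proof (rule cvec.independent_if_scalars_zero)
  fix f x
  assume "(\<Sum>b\<in>set H1i_basis. f b *\<^sub>C b) = 0" and x: "x \<in> set H1i_basis"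
  \<comment> \<open>\<open>coords\<close> sends the basis to distinct unit vectors, so each scalar
    is an entry of this equation.\<close>
  then have "coords (\<Sum>b\<in>set H1i_basis. f b *\<^sub>C b) = 0" by (simp add: coords_zero)
  then show "f x = 0"
    using x unfolding sum_basis
    by (auto simp: H1i_basis_def coords_add coords_cscale coords_basis cscale_prod_def cscale_complex_def
        zero_prod_def)
qed simp

lemma span_basis: "cvec.span (set H1i_basis) = UNIV"
proof (intro equalityI subset_UNIV subsetI)
  fix x :: H1i
  obtain a b n where n: "n \<in> N1" and x: "x = a *\<^sub>C e0 + b *\<^sub>C e1 + n" using H1i_decomp by blast
  have "N1 \<subseteq> cvec.span (set H1i_basis)"
    unfolding N1_def by (rule cvec.span_mono) (simp add: H1i_basis_def)
  then show "x \<in> cvec.span (set H1i_basis)"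
    using n unfolding x
    by (auto intro!: cvec.span_add cvec.span_scale intro: cvec.span_base simp: H1i_basis_def)
qed

section \<open>The adjoint representation and its trace\<close>

lemma mu_minus: "\<mu> a (- x) = - \<mu> a x" "\<mu> a (x - y) = \<mu> a x - \<mu> a y" "\<mu> a 0 = 0"
proof -
  show z: "\<mu> a 0 = 0" using mu_add(2)[of a 0 0] by simp
  show m: "\<mu> a (- x) = - \<mu> a x" for x using mu_add(2)[of a x "- x"] z by (simp add: eq_neg_iff_add_eq_0 add.commute)
  show "\<mu> a (x - y) = \<mu> a x - \<mu> a y" using mu_add(2)[of a x "- y"] m by simp
qed

text \<open>These are the Sweedler sums for the generators; the second terms come from
  \<open>S(E) = -KE\<close> and \<open>S(F) = -FK\<close>.\<close>

lemma mu_gen: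
  "\<mu> HK x = HK * x * HK"
  "\<mu> HE x = HE * x - HK * x * HK * HE"
  "\<mu> HF x = HF * x * HK - x * HF * HK"
  by (simp_all add: adj_rep_def Delta_values sandwich_add sandwich_tensor antipode_values antipode_one mult.assoc)

lemma mu_HK:
  "\<mu> HK e0 = e0" "\<mu> HK e1 = e1" "\<mu> HK E0 = - E0" "\<mu> HK E1 = - E1"
  "\<mu> HK F0 = - F0" "\<mu> HK F1 = - F1" "\<mu> HK C0 = C0" "\<mu> HK C1 = C1"
  by (simp_all add: mu_gen H1i_gen_mult_left H1i_gen_mult_right)

lemma mu_HE:
  "\<mu> HE e0 = - E0 + E1" "\<mu> HE e1 = E0 - E1" "\<mu> HE E0 = 0" "\<mu> HE E1 = 0"
  "\<mu> HE F0 = C0 + C1" "\<mu> HE F1 = C0 + C1" "\<mu> HE C0 = 0" "\<mu> HE C1 = 0"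
  by (simp_all add: mu_gen H1i_gen_mult_left H1i_gen_mult_right)

lemma mu_HF:
  "\<mu> HF e0 = F0 + F1" "\<mu> HF e1 = - F0 - F1" "\<mu> HF E0 = - C0 - C1" "\<mu> HF E1 = C0 + C1"
  "\<mu> HF F0 = 0" "\<mu> HF F1 = 0" "\<mu> HF C0 = 0" "\<mu> HF C1 = 0"
  by (simp_all add: mu_gen H1i_gen_mult_left H1i_gen_mult_right)

lemma half_double: "(1 / 2) *\<^sub>C (x + x) = x" for x :: "'a::complex_algebra"
  by (simp add: cscale_add_right cscale_add_left[symmetric] cscale_one)

text \<open>\<open>HK\<close> acts by conjugation, an involution, so \<open>e0\<close> and
  \<open>e1\<close> act as the projections onto its eigenspaces for 1 and -1.\<close>

lemma mu_e: "\<mu> e0 x = (1 / 2) *\<^sub>C (x + \<mu> HK x)" "\<mu> e1 x = (1 / 2) *\<^sub>C (x - \<mu> HK x)"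
proof -
  have "\<mu> (1 - HK) x = x - \<mu> HK x"
    using mu_add(1)[of "1 - HK" HK x] by (simp add: mu_one eq_diff_eq)
  then show "\<mu> e0 x = (1 / 2) *\<^sub>C (x + \<mu> HK x)" "\<mu> e1 x = (1 / 2) *\<^sub>C (x - \<mu> HK x)"
    by (simp_all add: e0_def e1_def mu_cscale mu_add mu_one)
qed

lemma mu_e_basis:
  "map (\<mu> e0) H1i_basis = [e0, e1, 0, 0, 0, 0, C0, C1]"
  "map (\<mu> e1) H1i_basis = [0, 0, E0, E1, F0, F1, 0, 0]"
  by (simp_all add: H1i_basis_def mu_e mu_HK half_double cscale_minus_simps(4))

lemma mu_e_values:
  "\<mu> e0 e0 = e0" "\<mu> e0 e1 = e1" "\<mu> e0 E0 = 0" "\<mu> e0 E1 = 0"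
  "\<mu> e0 F0 = 0" "\<mu> e0 F1 = 0" "\<mu> e0 C0 = C0" "\<mu> e0 C1 = C1"
  "\<mu> e1 e0 = 0" "\<mu> e1 e1 = 0" "\<mu> e1 E0 = E0" "\<mu> e1 E1 = E1"
  "\<mu> e1 F0 = F0" "\<mu> e1 F1 = F1" "\<mu> e1 C0 = 0" "\<mu> e1 C1 = 0"
  using mu_e_basis by (simp_all add: H1i_basis_def)

lemmas mu_values = mu_add(2) mu_minus mu_HE mu_HF mu_e_values

lemma two_cscale: "2 *\<^sub>C x = x + x" "(- 2) *\<^sub>C x = - x - x" for x :: "'a::complex_algebra"
  using cscale_add_left[of 1 1 x] by (simp_all add: cscale_one cscale_minus_simps)

text \<open>Multiplicativity reduces the nilpotent elements to the tables for \<open>HE\<close> and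
  \<open>HF\<close>, followed by a projection.\<close>

lemma mu_nil:
  "\<mu> E0 x = \<mu> e0 (\<mu> HE x)" "\<mu> E1 x = \<mu> e1 (\<mu> HE x)"
  "\<mu> F0 x = \<mu> e0 (\<mu> HF x)" "\<mu> F1 x = \<mu> e1 (\<mu> HF x)"
  "\<mu> C0 x = \<mu> e0 (\<mu> HE (\<mu> HF x))" "\<mu> C1 x = \<mu> e1 (\<mu> HE (\<mu> HF x))"
  by (simp_all add: E0_def E1_def F0_def F1_def C0_def C1_def mu_mult)

lemma mu_nil_basis:
  "map (\<mu> E0) H1i_basis = [0, 0, 0, 0, C0 + C1, C0 + C1, 0, 0]"
  "map (\<mu> E1) H1i_basis = [- E0 + E1, E0 - E1, 0, 0, 0, 0, 0, 0]"
  "map (\<mu> F0) H1i_basis = [0, 0, - C0 - C1, C0 + C1, 0, 0, 0, 0]"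
  "map (\<mu> F1) H1i_basis = [F0 + F1, - F0 - F1, 0, 0, 0, 0, 0, 0]"
  "map (\<mu> C0) H1i_basis = [2 *\<^sub>C (C0 + C1), (- 2) *\<^sub>C (C0 + C1), 0, 0, 0, 0, 0, 0]"
  "map (\<mu> C1) H1i_basis = [0, 0, 0, 0, 0, 0, 0, 0]"
  by (simp_all add: H1i_basis_def mu_nil mu_values two_cscale algebra_simps)

lemma mu_linear: "Vector_Spaces.linear (*\<^sub>C) (*\<^sub>C) (\<mu> a)"
  by unfold_locales (rule mu_add mu_cscale)+

lemma mu_C1: "\<mu> C1 = (\<lambda>x. 0)"
proof
  fix x
  \<comment> \<open>Vanishing is known on the basis only; linearity extends it to the span, which is
    everything.\<close>
  have "x \<in> cvec.span (set H1i_basis)" by (simp add: span_basis)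
  then show "\<mu> C1 x = 0"
    by (induction rule: cvec.span_induct_alt)
      (use mu_nil_basis(6) in \<open>auto simp: mu_minus mu_add mu_cscale H1i_basis_def cscale_minus_simps\<close>)
qed

section \<open>Traces of the basis elements\<close>

lemma Tr_mu_eq: "Tr_mu a = (\<Sum>b\<in>set H1i_basis. cvec.representation (set H1i_basis) (\<mu> a b) b)"
  unfolding Tr_mu_def by (rule cvec.ltrace_eq[OF mu_linear _ independent_basis span_basis]) simp

lemmas basis_representation =
  cvec.representation_add[OF independent_basis] cvec.representation_diff[OF independent_basis]
  cvec.representation_neg[OF independent_basis] cvec.representation_scale[OF independent_basis]
  cvec.representation_zero

lemma Tr_mu_add: "Tr_mu (a + b) = Tr_mu a + Tr_mu b"
  and Tr_mu_cscale: "Tr_mu (c *\<^sub>C a) = c * Tr_mu a"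
  by (simp_all add: Tr_mu_eq mu_add mu_cscale basis_representation span_basis sum.distrib sum_distrib_left)

text \<open>Only diagonal entries count: \<open>e0\<close> and \<open>e1\<close> each fix four basis
  elements and kill the others, while the nilpotent elements send each basis element to a
  combination of other ones.\<close>

lemma Tr_mu_basis: "map Tr_mu H1i_basis = [4, 4, 0, 0, 0, 0, 0, 0]"
proof -
  define R where "R = cvec.representation (set H1i_basis)"
  have R: "R (x + y) b = R x b + R y b" "R (x - y) b = R x b - R y b" "R (- x) b = - R x b"
    "R (c *\<^sub>C x) b = c * R x b" "R 0 b = 0" for x y b c
    by (simp_all add: R_def basis_representation span_basis)
  have "R b = (\<lambda>v. if v = b then 1 else 0)" if "b \<in> set H1i_basis" for b
    unfolding R_def by (rule cvec.representation_basis[OF independent_basis that])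
  then have Rb: "R e0 b = (if b = e0 then 1 else 0)" "R e1 b = (if b = e1 then 1 else 0)"
    "R E0 b = (if b = E0 then 1 else 0)" "R E1 b = (if b = E1 then 1 else 0)"
    "R F0 b = (if b = F0 then 1 else 0)" "R F1 b = (if b = F1 then 1 else 0)"
    "R C0 b = (if b = C0 then 1 else 0)" "R C1 b = (if b = C1 then 1 else 0)" for b
    by (simp_all add: H1i_basis_def)
  have T: "Tr_mu a = R (\<mu> a e0) e0 + (R (\<mu> a e1) e1 + (R (\<mu> a E0) E0 + (R (\<mu> a E1) E1 +
      (R (\<mu> a F0) F0 + (R (\<mu> a F1) F1 + (R (\<mu> a C0) C0 + R (\<mu> a C1) C1))))))" for a
    unfolding Tr_mu_eq sum_basis R_def ..
  show ?thesis
    unfolding H1i_basis_def list.map T mu_nil mu_values R Rb using distinct_basis by (simp add: H1i_basis_def)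
qed

lemma Tr_mu_N1: "a \<in> N1 \<Longrightarrow> Tr_mu a = 0"
proof (induction rule: N1_induct)
  case zero
  show ?case using Tr_mu_cscale[of 0 0] by (simp add: cscale_minus_simps)
qed (use Tr_mu_basis in \<open>simp_all add: H1i_basis_def Tr_mu_add Tr_mu_cscale\<close>)

section \<open>The two characters\<close>

text \<open>Both characters kill \<open>N1\<close>; their values 1 and -1 on \<open>HK\<close> make
  each of them pick out one idempotent.\<close>

lemma character_decomp:
  assumes "n \<in> N1"
  shows "counit (a *\<^sub>C e0 + b *\<^sub>C e1 + n) = a" "sign_char (a *\<^sub>C e0 + b *\<^sub>C e1 + n) = b"
  using H1i_char[OF counit_hom counit_values(2,3) assms] H1i_char[OF sign_char_hom sign_char_values(2,3) assms]
  by (simp_all add: counit_values sign_char_values)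

lemma Tr_mu_characters: "Tr_mu a = 4 * (counit a + sign_char a)"
proof -
  obtain \<alpha> \<beta> n where n: "n \<in> N1" and a: "a = \<alpha> *\<^sub>C e0 + \<beta> *\<^sub>C e1 + n" using H1i_decomp by blast
  have "Tr_mu e0 = 4" "Tr_mu e1 = 4" using Tr_mu_basis by (simp_all add: H1i_basis_def)
  then show ?thesis
    unfolding a character_decomp[OF n] by (simp add: Tr_mu_add Tr_mu_cscale Tr_mu_N1[OF n] algebra_simps)
qed

lemma N1_iff_characters: "x \<in> N1 \<longleftrightarrow> counit x = 0 \<and> sign_char x = 0"
proof -
  obtain a b n where n: "n \<in> N1" and x: "x = a *\<^sub>C e0 + b *\<^sub>C e1 + n" using H1i_decomp by blast
  show ?thesis
    \<comment> \<open>With zero coefficients the first instance treats \<open>x\<close> in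
      \<open>N1\<close>; the second reads off the coefficients of a general
      \<open>x\<close>.\<close>
    using character_decomp[of x 0 0] character_decomp[OF n, of a b] n x
    by (auto simp: cscale_minus_simps)
qed

lemma character_hom:
  "counit 1 = 1" "counit (x + y) = counit x + counit y" "counit (x * y) = counit x * counit y"
  "counit (c *\<^sub>C x) = c * counit x"
  "sign_char 1 = 1" "sign_char (x + y) = sign_char x + sign_char y"
  "sign_char (x * y) = sign_char x * sign_char y" "sign_char (c *\<^sub>C x) = c * sign_char x"
  using counit_hom sign_char_hom by (simp_all add: algebra_hom_def cscale_complex_def)

lemma character_diff: "counit (x - y) = counit x - counit y" "sign_char (x - y) = sign_char x - sign_char y"
  using character_hom(2)[of "x - y" y] character_hom(6)[of "x - y" y] by simp_all

section \<open>The semisimple quotient\<close>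

lift_definition ss_characters :: "H1i_ss \<Rightarrow> complex \<times> complex" is "\<lambda>x. (counit x, sign_char x)"
  by (simp add: N1_iff_characters character_diff)

lemma ss_characters_iso: "algebra_iso ss_characters"
proof -
  have "algebra_hom ss_characters"
    unfolding algebra_hom_def
  proof (intro conjI allI)
    show "ss_characters 1 = 1" by transfer (simp add: character_hom one_prod_def)
    show "ss_characters (x + y) = ss_characters x + ss_characters y" for x y
      by transfer (simp add: character_hom)
    show "ss_characters (x * y) = ss_characters x * ss_characters y" for x y
      by transfer (simp add: character_hom times_prod_def)
    show "ss_characters (c *\<^sub>C x) = c *\<^sub>C ss_characters x" for c x
      by transfer (simp add: character_hom cscale_prod_def cscale_complex_def)
  qed
  moreover have "inj ss_characters"
    unfolding inj_def by transfer (simp add: N1_iff_characters character_diff)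
  moreover have "surj ss_characters"
  \<comment> \<open>The summand \<open>0\<close>, an element of \<open>N1\<close>, gives the
    representative the shape of \<open>character_decomp\<close>; hence also the deletion of
    \<open>add_0_right\<close> below.\<close>
  proof (rule surjI[of _ "\<lambda>(a, b). ss_proj (a *\<^sub>C e0 + b *\<^sub>C e1 + 0)"])
    show "ss_characters (case z of (a, b) \<Rightarrow> ss_proj (a *\<^sub>C e0 + b *\<^sub>C e1 + 0)) = z" for z
      by (simp add: ss_proj_def ss_characters.abs_eq character_decomp[OF N1_closed(1)] del: add_0_right
          split: prod.split)
  qed
  ultimately show ?thesis by (simp add: algebra_iso_def bij_def)
qed

section \<open>The scalar product\<close>

lemma character_star: "counit (star x) = cnj (counit x) \<and> sign_char (star x) = cnj (sign_char x)"
  \<comment> \<open>The star exchanges \<open>HE\<close> and \<open>HF\<close>, both killed by the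
    characters, and the reversed order of factors is invisible in the commutative field of
    values.\<close>
  by (induction x rule: H1i_induct)
    (simp_all add: star_one star_add star_mult star_cscale star_values character_hom counit_values
      sign_char_values)

lemma scalar_prod_characters:
  "scalar_prod a b = cnj (counit a) * counit b + cnj (sign_char a) * sign_char b"
  by (simp add: scalar_prod_def Tr_mu_characters character_hom character_star)

lemma character_basis:
  "map counit H1i_basis = [1, 0, 0, 0, 0, 0, 0, 0]" "map sign_char H1i_basis = [0, 1, 0, 0, 0, 0, 0, 0]"
  using character_decomp[OF N1_closed(1), of 1 0] character_decomp[OF N1_closed(1), of 0 1]
    N1_base[unfolded N1_iff_characters]
  by (simp_all add: H1i_basis_def cscale_one cscale_minus_simps)

lemma scalar_prod_basis:
  assumes "i < 8" "j < 8"
  shows "scalar_prod (H1i_basis ! i) (H1i_basis ! j) = (if i = j \<and> i < 2 then 1 else 0)"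
proof -
  have "counit (H1i_basis ! k) = (if k = 0 then 1 else 0)"
    "sign_char (H1i_basis ! k) = (if k = 1 then 1 else 0)" if "k < 8" for k
  proof -
    have "k \<in> {0, 1, 2, 3, 4, 5, 6, 7}" using that by auto
    then show "counit (H1i_basis ! k) = (if k = 0 then 1 else 0)"
      "sign_char (H1i_basis ! k) = (if k = 1 then 1 else 0)"
      using character_basis by (auto simp: H1i_basis_def)
  qed
  then show ?thesis using assms by (auto simp: scalar_prod_characters)
qed

text \<open>On the diagonal the form is a sum of two squared moduli.\<close>

lemma scalar_prod_pos_semidef: "pos_semidef_form scalar_prod"
proof -
  have "cnj z * z = complex_of_real ((cmod z)\<^sup>2)" for z
    by (simp only: complex_norm_square mult.commute)
  then have "scalar_prod a a = complex_of_real ((cmod (counit a))\<^sup>2 + (cmod (sign_char a))\<^sup>2)" for a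
    by (simp add: scalar_prod_characters)
  then have "scalar_prod a a \<in> \<real> \<and> 0 \<le> Re (scalar_prod a a)" for a
    by (simp del: of_real_add)
  then show ?thesis
    by (simp add: pos_semidef_form_def scalar_prod_characters character_hom algebra_simps)
qed

lemma scalar_prod_null_space: "null_space scalar_prod = N1"
proof
  show "N1 \<subseteq> null_space scalar_prod"
    by (auto simp: null_space_def scalar_prod_characters N1_iff_characters)
  show "null_space scalar_prod \<subseteq> N1"
  proof
    fix a assume "a \<in> null_space scalar_prod"
    \<comment> \<open>Pairing with \<open>e0\<close> and \<open>e1\<close> isolates the conjugates
      of the two characters of \<open>a\<close>.\<close>
    then have "scalar_prod a e0 = 0" "scalar_prod a e1 = 0" by (simp_all add: null_space_def)
    then show "a \<in> N1"
      using character_basis by (simp add: scalar_prod_characters N1_iff_characters H1i_basis_def)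
  qed
qed

theorem proposition4p1:
  shows
    "(map (\<mu> e0) H1i_basis = [e0, e1, 0, 0, 0, 0, C0, C1] \<and>
      map (\<mu> e1) H1i_basis = [0, 0, E0, E1, F0, F1, 0, 0] \<and>
      map (\<mu> E0) H1i_basis = [0, 0, 0, 0, C0 + C1, C0 + C1, 0, 0] \<and>
      map (\<mu> E1) H1i_basis = [- E0 + E1, E0 - E1, 0, 0, 0, 0, 0, 0] \<and>
      map (\<mu> F0) H1i_basis = [0, 0, - C0 - C1, C0 + C1, 0, 0, 0, 0] \<and>
      map (\<mu> F1) H1i_basis = [F0 + F1, - F0 - F1, 0, 0, 0, 0, 0, 0] \<and>
      map (\<mu> C0) H1i_basis = [2 *\<^sub>C (C0 + C1), (- 2) *\<^sub>C (C0 + C1), 0, 0, 0, 0, 0, 0] \<and>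
      \<mu> C1 = (\<lambda>x. 0)) \<and>
     (map Tr_mu H1i_basis = [4, 4, 0, 0, 0, 0, 0, 0] \<and>
      (\<forall>a\<in>N1. Tr_mu a = 0) \<and>
      (\<exists>\<tau> :: H1i_ss \<Rightarrow> complex. (\<forall>a. Tr_mu a = \<tau> (ss_proj a)) \<and>
        (\<exists>\<phi> :: H1i_ss \<Rightarrow> complex \<times> complex. algebra_iso \<phi> \<and>
          (\<forall>x. \<tau> x = 4 * (fst (\<phi> x) + snd (\<phi> x)))))) \<and>
     ((\<forall>i<8. \<forall>j<8. scalar_prod (H1i_basis ! i) (H1i_basis ! j) = (if i = j \<and> i < 2 then 1 else 0)) \<and>
      pos_semidef_form scalar_prod \<and>
      null_space scalar_prod = N1)"
proof -
  have "Tr_mu a = 4 * (fst (ss_characters (ss_proj a)) + snd (ss_characters (ss_proj a)))" for a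
    by (simp add: Tr_mu_characters ss_proj_def ss_characters.abs_eq)
  then have "\<exists>\<tau> :: H1i_ss \<Rightarrow> complex. (\<forall>a. Tr_mu a = \<tau> (ss_proj a)) \<and>
      (\<exists>\<phi> :: H1i_ss \<Rightarrow> complex \<times> complex. algebra_iso \<phi> \<and> (\<forall>x. \<tau> x = 4 * (fst (\<phi> x) + snd (\<phi> x))))"
    using ss_characters_iso
    \<comment> \<open>The functional is four times the usual trace on pairs, pulled back along
      \<open>ss_characters\<close>.\<close>
    by (intro exI[of _ "\<lambda>x. 4 * (fst (ss_characters x) + snd (ss_characters x))"]) blast
  then show ?thesis
    using mu_e_basis mu_nil_basis(1-5) mu_C1 Tr_mu_basis Tr_mu_N1 scalar_prod_basis
      scalar_prod_pos_semidef scalar_prod_null_space by blast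
qed

end
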